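(* Let $d$ be a positive integer. Let $G$ be the union of the graphs $G_1=(V_1,E_1)$ and $G_2=(V_2,E_2)$ with $|V_1\cap V_2|\in\{d,d+1\}$, where $G_1$ and $G_2$ are both redundantly $d$-rigid. Then $G-uv$ is redundantly $d$-rigid for any $uv\in E_1\cap E_2$.
   Context: Graphs are finite and simple, with a nonempty edge set. The union of $G_1,G_2$ is $(V_1\cup V_2,E_1\cup E_2)$; $G-e$ is $G$ with the edge $e$ deleted. Let $G=(V,E)$. For $p:V\to\mathbb{C}^d$ put $m_{d,G}(p)=\big(\sum_{i=1}^d(p(u)_i-p(v)_i)^2\big)_{uv\in E}\in\mathbb{C}^E$; $p$ is generic if its $d|V|$ coordinates do not satisfy any nonzero polynomial with rational coefficients. The generic rigidity matroid $\mathcal{R}_d(G)$ is the matroid on $E$ given by the rows of the Jacobian matrix of $m_{d,G}$ at any generic configuration $p$ (the result does not depend on $p$). $G$ is $d$-rigid if $E$ is a spanning set of $\mathcal{R}_d(K_V)$, where $K_V$ is the complete graph on $V$. $G$ is redundantly $d$-rigid if it remains $d$-rigid after the deletion of any edge. *)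

theory Defs
  imports "HOL-Analysis.Analysis" "HOL-Library.Poly_Mapping"
begin

definition complete_edges :: "'v set \<Rightarrow> 'v set set" where
  "complete_edges V = {{u, v} |u v. u \<in> V \<and> v \<in> V \<and> u \<noteq> v}"

definition simple_graph :: "'v set \<Rightarrow> 'v set set \<Rightarrow> bool" where
  "simple_graph V E \<longleftrightarrow> finite V \<and> E \<subseteq> complete_edges V \<and> E \<noteq> {}"

text \<open>A configuration is a function \<open>p\<close> of type \<open>'v \<Rightarrow> nat \<Rightarrow> complex\<close>, where \<open>p v i\<close> with
  \<open>v \<in> V\<close> and \<open>i < d\<close> is the \<open>i\<close>-th coordinate of the point assigned to \<open>v\<close>; its other
  values are irrelevant. A polynomial over the rationals in variables of type \<open>'x\<close> is a
  finitely supported map from monomials \<open>'x \<Rightarrow>\<^sub>0 nat\<close> to coefficients.\<close>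

definition eval_poly :: "('x \<Rightarrow> complex) \<Rightarrow> (('x \<Rightarrow>\<^sub>0 nat) \<Rightarrow>\<^sub>0 rat) \<Rightarrow> complex" where
  "eval_poly f P =
     (\<Sum>m \<in> Poly_Mapping.keys P. of_rat (Poly_Mapping.lookup P m) *
        (\<Prod>x \<in> Poly_Mapping.keys m. f x ^ Poly_Mapping.lookup m x))"

definition poly_vars :: "(('x \<Rightarrow>\<^sub>0 nat) \<Rightarrow>\<^sub>0 rat) \<Rightarrow> 'x set" where
  "poly_vars P = (\<Union>m \<in> Poly_Mapping.keys P. Poly_Mapping.keys m)"

definition generic :: "nat \<Rightarrow> 'v set \<Rightarrow> ('v \<Rightarrow> nat \<Rightarrow> complex) \<Rightarrow> bool" where
  "generic d V p \<longleftrightarrow>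
     (\<forall>P :: (('v \<times> nat) \<Rightarrow>\<^sub>0 nat) \<Rightarrow>\<^sub>0 rat.
        P \<noteq> 0 \<and> poly_vars P \<subseteq> V \<times> {..<d} \<longrightarrow> eval_poly (\<lambda>(v, i). p v i) P \<noteq> 0)"

text \<open>The coordinate of the measurement map at an edge. The description is well defined for
  every edge \<open>e = {u, v}\<close>, since the sum is symmetric in \<open>u\<close> and \<open>v\<close>.\<close>

definition measurement :: "nat \<Rightarrow> ('v \<Rightarrow> nat \<Rightarrow> complex) \<Rightarrow> 'v set \<Rightarrow> complex" where
  "measurement d p e = (THE c. \<exists>u v. e = {u, v} \<and> c = (\<Sum>i<d. (p u i - p v i)\<^sup>2))"

definition jacobian ::
  "nat \<Rightarrow> ('v \<Rightarrow> nat \<Rightarrow> complex) \<Rightarrow> 'v set \<Rightarrow> 'v \<Rightarrow> nat \<Rightarrow> complex" where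
  "jacobian d p e w i =
     deriv (\<lambda>z. measurement d (p(w := (p w)(i := z))) e) (p w i)"

definition rows_independent ::
  "nat \<Rightarrow> 'v set \<Rightarrow> ('v \<Rightarrow> nat \<Rightarrow> complex) \<Rightarrow> 'v set set \<Rightarrow> bool" where
  "rows_independent d V p F \<longleftrightarrow>
     (\<forall>c :: 'v set \<Rightarrow> complex.
        (\<forall>w\<in>V. \<forall>i<d. (\<Sum>e\<in>F. c e * jacobian d p e w i) = 0) \<longrightarrow> (\<forall>e\<in>F. c e = 0))"

text \<open>Matroids are represented by their families of independent sets. Independence of the
  rows indexed by \<open>F\<close> is the same at all generic configurations, and generic configurations
  exist for every finite \<open>V\<close>.\<close>

definition rigidity_matroid :: "nat \<Rightarrow> 'v set \<Rightarrow> 'v set set \<Rightarrow> 'v set set set" where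
  "rigidity_matroid d V E =
     {F. F \<subseteq> E \<and> (\<forall>p. generic d V p \<longrightarrow> rows_independent d V p F)}"

definition matroid_basis :: "'e set set \<Rightarrow> 'e set \<Rightarrow> bool" where
  "matroid_basis \<I> B \<longleftrightarrow> B \<in> \<I> \<and> (\<forall>B'\<in>\<I>. B \<subseteq> B' \<longrightarrow> B' = B)"

definition matroid_spanning :: "'e set set \<Rightarrow> 'e set \<Rightarrow> bool" where
  "matroid_spanning \<I> S \<longleftrightarrow> (\<exists>B\<subseteq>S. matroid_basis \<I> B)"

definition d_rigid :: "nat \<Rightarrow> 'v set \<Rightarrow> 'v set set \<Rightarrow> bool" where
  "d_rigid d V E \<longleftrightarrow> matroid_spanning (rigidity_matroid d V (complete_edges V)) E"

definition redundantly_d_rigid :: "nat \<Rightarrow> 'v set \<Rightarrow> 'v set set \<Rightarrow> bool" where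
  "redundantly_d_rigid d V E \<longleftrightarrow> d_rigid d V E \<and> (\<forall>e\<in>E. d_rigid d V (E - {e}))"

end

theory Submission
  imports Defs
begin

text \<open>
  Fix a generic configuration \<open>p\<close>. By linear duality a graph is \<open>d\<close>-rigid if and only
  if each of its infinitesimal motions at \<open>p\<close> preserves the lengths of all pairs of vertices
  (\<open>d_rigid_iff_motions\<close>). Two rigid graphs with at least \<open>d\<close> common vertices have a
  rigid union (\<open>rigid_bodies_glue\<close>), so it suffices that a motion of the union without
  \<open>uv\<close> and one more edge \<open>f\<close> is rigid on both vertex sets. If \<open>f\<close> belongs to
  only one of the two graphs, the other graph without \<open>uv\<close> is rigid and gives \<open>uv\<close>
  back to the first.

  The essential case is that \<open>f\<close> is a second common edge. Each graph, deprived of both edges,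
  may then have a one-parameter flexibility under which the rates of change of the two edges have a
  fixed ratio, and the union has a motion changing them only if the two ratios coincide. At a generic
  configuration they do not: there are at most \<open>d + 1\<close> common vertices, so a perspective
  transformation can fix all of them and change the ratio of one graph, since it scales the strain of
  an edge by weights attached to its endpoints (\<open>perspective_strain\<close>) and the two edges differ
  in an endpoint. Transforming one graph only, by a map close to the identity, gives a
  configuration with distinct ratios at which the rank cannot have dropped; as it cannot exceed the
  generic rank either, a nontrivial motion at \<open>p\<close> is impossible
  (\<open>linked_pair_determined_by_two_sides\<close>).

  The comparison of ranks at different configurations rests on \<open>row_independent_persists\<close>,
  and generic configurations exist because there are only countably many rational polynomials
  (\<open>exists_generic\<close>).
\<close>

section \<open>Linear independence of finite families of rows\<close>
definition row_independent :: "'j set \<Rightarrow> ('e \<Rightarrow> 'j \<Rightarrow> complex) \<Rightarrow> 'e set \<Rightarrow> bool" where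
  "row_independent J M F \<longleftrightarrow>
     (\<forall>c. (\<forall>j\<in>J. (\<Sum>e\<in>F. c e * M e j) = 0) \<longrightarrow> (\<forall>e\<in>F. c e = 0))"

lemma row_independent_mono:
  assumes "finite F" "F' \<subseteq> F" "row_independent J M F"
  shows "row_independent J M F'"
  unfolding row_independent_def
proof (intro allI impI)
  fix c assume c: "\<forall>j\<in>J. (\<Sum>e\<in>F'. c e * M e j) = 0"
  let ?c = "\<lambda>e. if e \<in> F' then c e else 0"
  have "(\<Sum>e\<in>F. ?c e * M e j) = (\<Sum>e\<in>F'. c e * M e j)" for j
    using assms(1,2) by (intro sum.mono_neutral_cong_right) auto
  then have "\<forall>j\<in>J. (\<Sum>e\<in>F. ?c e * M e j) = 0"
    using c by simp
  then have "\<forall>e\<in>F. ?c e = 0"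
    using assms(3) unfolding row_independent_def by (elim allE[of _ ?c] impE)
  then show "\<forall>e\<in>F'. c e = 0"
    using assms(2) by (metis subsetD)
qed

lemma row_independent_nonzero_entry:
  assumes "finite F" "row_independent J M F" "e \<in> F"
  obtains j where "j \<in> J" "M e j \<noteq> 0"
proof -
  have "row_independent J M {e}"
    using row_independent_mono[OF assms(1) _ assms(2), of "{e}"] assms(3) by simp
  then have "\<exists>j\<in>J. M e j \<noteq> 0"
    unfolding row_independent_def by (auto dest: spec[of _ "\<lambda>_. 1"])
  then show thesis using that by blast
qed

text \<open>One step of Gaussian elimination. It is free of division, so when the entries depend on a
  parameter the new entries are polynomials in the old ones; both the persistence of independence
  and the solvability of linear systems follow by induction from this one equivalence.\<close>
lemma row_independent_pivot:
  assumes "finite F" "e \<notin> F" "j \<in> J" "M e j \<noteq> 0"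
  shows "row_independent J M (insert e F) \<longleftrightarrow>
    row_independent J (\<lambda>f k. M e j * M f k - M f j * M e k) F"
    (is "_ \<longleftrightarrow> row_independent J ?N F")
proof
  assume L: "row_independent J M (insert e F)"
  show "row_independent J ?N F"
    unfolding row_independent_def
  proof (intro allI impI)
    fix c assume c: "\<forall>k\<in>J. (\<Sum>f\<in>F. c f * ?N f k) = 0"
    let ?c = "\<lambda>f. if f = e then - (\<Sum>g\<in>F. c g * M g j) else M e j * c f"
    have "(\<Sum>f\<in>insert e F. ?c f * M f k) = (\<Sum>f\<in>F. c f * ?N f k)" for k
    proof -
      have "(\<Sum>f\<in>F. ?c f * M f k) = (\<Sum>f\<in>F. M e j * c f * M f k)"
        using assms(2) by (intro sum.cong) auto
      then show ?thesis
        using assms(1,2)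
        by (simp add: sum_subtractf sum_distrib_left sum_distrib_right algebra_simps)
    qed
    then have "\<forall>k\<in>J. (\<Sum>f\<in>insert e F. ?c f * M f k) = 0"
      using c by simp
    then have "\<forall>f\<in>insert e F. ?c f = 0"
      using L unfolding row_independent_def by (elim allE[of _ ?c] impE)
    then show "\<forall>f\<in>F. c f = 0"
      using assms(2,4) by (metis insertCI mult_eq_0_iff)
  qed
next
  assume R: "row_independent J ?N F"
  show "row_independent J M (insert e F)"
    unfolding row_independent_def
  proof (intro allI impI)
    fix c assume c: "\<forall>k\<in>J. (\<Sum>f\<in>insert e F. c f * M f k) = 0"
    have s: "(\<Sum>f\<in>F. c f * M f k) = - c e * M e k" if "k \<in> J" for k
      using c[rule_format, OF that] assms(1,2) by (simp add: add_eq_0_iff)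
    have "(\<Sum>f\<in>F. c f * ?N f k) = 0" if "k \<in> J" for k
    proof -
      have "(\<Sum>f\<in>F. c f * ?N f k) =
          M e j * (\<Sum>f\<in>F. c f * M f k) - (\<Sum>f\<in>F. c f * M f j) * M e k"
        by (simp add: sum_subtractf sum_distrib_left sum_distrib_right algebra_simps)
      then show ?thesis using s[OF that] s[OF assms(3)] by (simp add: algebra_simps)
    qed
    then have 0: "\<forall>f\<in>F. c f = 0" using R unfolding row_independent_def by blast
    with s[OF assms(3)] assms(4) have "c e = 0" by simp
    with 0 show "\<forall>f\<in>insert e F. c f = 0" by simp
  qed
qed

text \<open>Independence at a point \<open>q\<close> is witnessed by finitely many nonzero pivots, each of them
  obtained from the entries by subtraction and multiplication, so it holds wherever these pivots do
  not vanish. With \<open>R\<close> the polynomials in the coordinates and a principal filter this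
  says that generic configurations have maximal rank; with \<open>R\<close> the continuous functions it
  says that rank is lower semicontinuous.\<close>
lemma row_independent_persists:
  fixes M :: "'e \<Rightarrow> 'j \<Rightarrow> 'x \<Rightarrow> complex"
  assumes "finite F"
    and diff: "\<And>g h. g \<in> R \<Longrightarrow> h \<in> R \<Longrightarrow> (\<lambda>x. g x - h x) \<in> R"
    and mult: "\<And>g h. g \<in> R \<Longrightarrow> h \<in> R \<Longrightarrow> (\<lambda>x. g x * h x) \<in> R"
    and nonzero: "\<And>g. g \<in> R \<Longrightarrow> g q \<noteq> 0 \<Longrightarrow> \<forall>\<^sub>F x in Fil. g x \<noteq> 0"
    and "\<And>e j. e \<in> F \<Longrightarrow> j \<in> J \<Longrightarrow> M e j \<in> R"
    and "row_independent J (\<lambda>e j. M e j q) F"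
  shows "\<forall>\<^sub>F x in Fil. row_independent J (\<lambda>e j. M e j x) F"
  using assms(1,5,6)
proof (induction F arbitrary: M rule: finite_induct)
  case empty
  then show ?case by (simp add: row_independent_def)
next
  case (insert e F)
  obtain j where j: "j \<in> J" "M e j q \<noteq> 0"
    using row_independent_nonzero_entry[of "insert e F" J "\<lambda>e j. M e j q" e] insert by auto
  let ?N = "\<lambda>f k x. M e j x * M f k x - M f j x * M e k x"
  have "row_independent J (\<lambda>f k. ?N f k q) F"
    using row_independent_pivot[of F e j J "\<lambda>e j. M e j q"] insert j by blast
  then have "\<forall>\<^sub>F x in Fil. row_independent J (\<lambda>f k. ?N f k x) F"
    using insert.prems(1) j(1) by (intro insert.IH) (auto intro!: diff mult)
  moreover have "\<forall>\<^sub>F x in Fil. M e j x \<noteq> 0"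
    using nonzero insert.prems(1) j by blast
  ultimately show ?case
  proof eventually_elim
    case (elim x)
    then show ?case
      using row_independent_pivot[of F e j J "\<lambda>e j. M e j x"] insert.hyps j(1) by blast
  qed
qed

lemma row_independent_solve:
  fixes M :: "'e \<Rightarrow> 'j \<Rightarrow> complex"
  assumes "finite F" "finite J" "row_independent J M F"
  shows "\<exists>x. \<forall>e\<in>F. (\<Sum>j\<in>J. M e j * x j) = b e"
  using assms(1,3)
proof (induction F arbitrary: M b rule: finite_induct)
  case empty
  then show ?case by simp
next
  case (insert e F)
  obtain j where j: "j \<in> J" "M e j \<noteq> 0"
    using row_independent_nonzero_entry[of "insert e F" J M e] insert by auto
  let ?N = "\<lambda>f k. M e j * M f k - M f j * M e k"
  have "row_independent J ?N F"
    using row_independent_pivot[of F e j J M] insert j by blast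
  from insert.IH[OF this, of "\<lambda>f. M e j * b f - M f j * b e"]
  obtain x where x: "\<And>f. f \<in> F \<Longrightarrow> (\<Sum>k\<in>J. ?N f k * x k) = M e j * b f - M f j * b e"
    by blast
  define t where "t = (b e - (\<Sum>k\<in>J. M e k * x k)) / M e j"
  define y where "y k = x k + (if k = j then t else 0)" for k
  have y: "(\<Sum>k\<in>J. M f k * y k) = (\<Sum>k\<in>J. M f k * x k) + M f j * t" for f
  proof -
    have "(\<Sum>k\<in>J. M f k * y k) = (\<Sum>k\<in>J. M f k * x k + (if k = j then M f k * t else 0))"
      unfolding y_def by (intro sum.cong) (auto simp: algebra_simps)
    then show ?thesis using assms(2) j(1) by (simp add: sum.distrib)
  qed
  have e: "(\<Sum>k\<in>J. M e k * y k) = b e"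
    unfolding y t_def using j(2) by simp
  moreover have "(\<Sum>k\<in>J. M f k * y k) = b f" if "f \<in> F" for f
  proof -
    have "M e j * (\<Sum>k\<in>J. M f k * x k) - M f j * (\<Sum>k\<in>J. M e k * x k) = M e j * b f - M f j * b e"
      using x[OF that] by (simp add: sum_subtractf sum_distrib_left algebra_simps)
    moreover have "(\<Sum>k\<in>J. M e k * x k) = b e - M e j * t"
      using e unfolding y by (simp add: eq_diff_eq)
    ultimately have "M e j * ((\<Sum>k\<in>J. M f k * x k) + M f j * t) = M e j * b f"
      by (simp only:) (simp add: algebra_simps)
    then show ?thesis unfolding y using j(2) by simp
  qed
  ultimately show ?case by blast
qed

lemma row_dependent_insert:
  assumes "finite F" "e \<notin> F" "row_independent J M F" "\<not> row_independent J M (insert e F)"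
  obtains c where "\<And>j. j \<in> J \<Longrightarrow> M e j = (\<Sum>f\<in>F. c f * M f j)"
proof -
  obtain c where c: "\<And>j. j \<in> J \<Longrightarrow> (\<Sum>f\<in>insert e F. c f * M f j) = 0"
    and nz: "\<exists>f\<in>insert e F. c f \<noteq> 0"
    using assms(4) unfolding row_independent_def by blast
  have s: "(\<Sum>f\<in>F. c f * M f j) = - c e * M e j" if "j \<in> J" for j
    using c[OF that] assms(1,2) by (simp add: add_eq_0_iff)
  have "c e \<noteq> 0"
  proof
    assume "c e = 0"
    with s have "\<forall>f\<in>F. c f = 0" using assms(3) unfolding row_independent_def by simp
    with \<open>c e = 0\<close> nz show False by blast
  qed
  have "M e j = (\<Sum>f\<in>F. (- c f / c e) * M f j)" if "j \<in> J" for j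
  proof -
    have "(\<Sum>f\<in>F. (- c f / c e) * M f j) = (- 1 / c e) * (\<Sum>f\<in>F. c f * M f j)"
      by (simp add: sum_distrib_left)
    then show ?thesis using s[OF that] \<open>c e \<noteq> 0\<close> by simp
  qed
  then show thesis by (rule that)
qed

section \<open>Polynomials in the coordinates and generic configurations\<close>
lemma eval_poly_superset:
  assumes "finite A" "Poly_Mapping.keys P \<subseteq> A"
  shows "eval_poly f P = (\<Sum>m\<in>A. of_rat (Poly_Mapping.lookup P m) *
        (\<Prod>x \<in> Poly_Mapping.keys m. f x ^ Poly_Mapping.lookup m x))"
  unfolding eval_poly_def using assms
  by (intro sum.mono_neutral_left) (auto simp: in_keys_iff)

lemma eval_poly_add: "eval_poly f (P + Q) = eval_poly f P + eval_poly f Q"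
  using Poly_Mapping.keys_add[of P Q]
  by (simp add: eval_poly_superset[of "Poly_Mapping.keys P \<union> Poly_Mapping.keys Q"]
      lookup_add of_rat_add ring_distribs sum.distrib)

lemma eval_poly_uminus: "eval_poly f (- P) = - eval_poly f P"
  by (simp add: eval_poly_superset[of "Poly_Mapping.keys P"] in_keys_iff subset_iff
      of_rat_minus sum_negf)

lemma eval_poly_sum: "eval_poly f (sum P A) = (\<Sum>a\<in>A. eval_poly f (P a))"
proof (induction A rule: infinite_finite_induct)
  case (insert a A)
  then show ?case by (simp add: eval_poly_add)
qed (simp_all add: eval_poly_def)

lemma eval_poly_single:
  "eval_poly f (Poly_Mapping.single m a) =
     of_rat a * (\<Prod>x \<in> Poly_Mapping.keys m. f x ^ Poly_Mapping.lookup m x)"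
  by (subst eval_poly_superset[of "{m}"]) auto

lemma poly_mapping_sum_single:
  "(P :: 'a \<Rightarrow>\<^sub>0 'b::comm_monoid_add) =
     (\<Sum>m\<in>Poly_Mapping.keys P. Poly_Mapping.single m (Poly_Mapping.lookup P m))"
proof (rule poly_mapping_eqI)
  fix k
  show "Poly_Mapping.lookup P k = Poly_Mapping.lookup
      (\<Sum>m\<in>Poly_Mapping.keys P. Poly_Mapping.single m (Poly_Mapping.lookup P m)) k"
    by (cases "k \<in> Poly_Mapping.keys P")
      (auto simp: lookup_sum lookup_single when_def in_keys_iff)
qed

lemma monomial_value_add:
  fixes f :: "'x \<Rightarrow> complex"
  shows "(\<Prod>x\<in>Poly_Mapping.keys (m + n). f x ^ Poly_Mapping.lookup (m + n) x) =
   (\<Prod>x\<in>Poly_Mapping.keys m. f x ^ Poly_Mapping.lookup m x) *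
   (\<Prod>x\<in>Poly_Mapping.keys n. f x ^ Poly_Mapping.lookup n x)"
proof -
  let ?A = "Poly_Mapping.keys m \<union> Poly_Mapping.keys n"
  have *: "(\<Prod>x\<in>Poly_Mapping.keys k. f x ^ Poly_Mapping.lookup k x) =
      (\<Prod>x\<in>?A. f x ^ Poly_Mapping.lookup k x)" if "Poly_Mapping.keys k \<subseteq> ?A" for k
    using that by (intro prod.mono_neutral_left) (auto simp: in_keys_iff)
  show ?thesis
    using *[OF Poly_Mapping.keys_add[of m n]] *[of m] *[of n]
    by (simp add: lookup_add power_add prod.distrib)
qed

lemma eval_poly_mult: "eval_poly f (P * Q) = eval_poly f P * eval_poly f Q"
proof -
  have "P * Q = (\<Sum>m\<in>Poly_Mapping.keys P. \<Sum>n\<in>Poly_Mapping.keys Q.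
      Poly_Mapping.single (m + n) (Poly_Mapping.lookup P m * Poly_Mapping.lookup Q n))"
    by (subst poly_mapping_sum_single[of P], subst poly_mapping_sum_single[of Q])
      (simp add: sum_product mult_single)
  then have "eval_poly f (P * Q) = (\<Sum>m\<in>Poly_Mapping.keys P. \<Sum>n\<in>Poly_Mapping.keys Q.
      eval_poly f (Poly_Mapping.single (m + n) (Poly_Mapping.lookup P m * Poly_Mapping.lookup Q n)))"
    by (simp add: eval_poly_sum)
  also have "\<dots> = eval_poly f P * eval_poly f Q"
    unfolding eval_poly_def[of f P] eval_poly_def[of f Q] sum_product eval_poly_single
      monomial_value_add of_rat_mult
    by (simp add: mult_ac)
  finally show ?thesis .
qed

definition config_polynomials :: "nat \<Rightarrow> 'v set \<Rightarrow> (('v \<Rightarrow> nat \<Rightarrow> complex) \<Rightarrow> complex) set" where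
  "config_polynomials d V =
     {g. \<exists>P. poly_vars P \<subseteq> V \<times> {..<d} \<and> (\<forall>p. g p = eval_poly (\<lambda>(v, i). p v i) P)}"

lemma config_polynomials_coordinate:
  assumes "v \<in> V" "i < d"
  shows "(\<lambda>p. p v i) \<in> config_polynomials d V"
proof -
  let ?P = "Poly_Mapping.single (Poly_Mapping.single (v, i) (1::nat)) (1::rat)"
  have "poly_vars ?P \<subseteq> V \<times> {..<d}" using assms by (simp add: poly_vars_def)
  moreover have "eval_poly f ?P = f (v, i)" for f
    by (simp add: eval_poly_single)
  ultimately show ?thesis
    unfolding config_polynomials_def by (intro CollectI exI[of _ ?P]) simp
qed

lemma config_polynomials_diff:
  assumes "g \<in> config_polynomials d V" "h \<in> config_polynomials d V"
  shows "(\<lambda>p. g p - h p) \<in> config_polynomials d V"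
proof -
  obtain P Q where P: "poly_vars P \<subseteq> V \<times> {..<d}" "\<And>p. g p = eval_poly (\<lambda>(v, i). p v i) P"
    and Q: "poly_vars Q \<subseteq> V \<times> {..<d}" "\<And>p. h p = eval_poly (\<lambda>(v, i). p v i) Q"
    using assms unfolding config_polynomials_def by blast
  have "poly_vars (P + - Q) \<subseteq> poly_vars P \<union> poly_vars Q"
    unfolding poly_vars_def using Poly_Mapping.keys_add[of P "- Q"]
    by (fastforce simp: in_keys_iff)
  moreover have "g p - h p = eval_poly (\<lambda>(v, i). p v i) (P + - Q)" for p
    by (simp add: eval_poly_add eval_poly_uminus P Q del: add_uminus_conv_diff)
  ultimately show ?thesis
    unfolding config_polynomials_def using P(1) Q(1)
    by (intro CollectI exI[of _ "P + - Q"]) blast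
qed

lemma config_polynomials_mult:
  assumes "g \<in> config_polynomials d V" "h \<in> config_polynomials d V"
  shows "(\<lambda>p. g p * h p) \<in> config_polynomials d V"
proof -
  obtain P Q where P: "poly_vars P \<subseteq> V \<times> {..<d}" "\<And>p. g p = eval_poly (\<lambda>(v, i). p v i) P"
    and Q: "poly_vars Q \<subseteq> V \<times> {..<d}" "\<And>p. h p = eval_poly (\<lambda>(v, i). p v i) Q"
    using assms unfolding config_polynomials_def by blast
  have "poly_vars (P * Q) \<subseteq> poly_vars P \<union> poly_vars Q"
  proof
    fix x assume "x \<in> poly_vars (P * Q)"
    then obtain m n where "m \<in> Poly_Mapping.keys P" "n \<in> Poly_Mapping.keys Q"
      "x \<in> Poly_Mapping.keys (m + n)"
      unfolding poly_vars_def using Poly_Mapping.keys_mult[of P Q] by blast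
    then show "x \<in> poly_vars P \<union> poly_vars Q"
      unfolding poly_vars_def using Poly_Mapping.keys_add[of m n] by blast
  qed
  moreover have "g p * h p = eval_poly (\<lambda>(v, i). p v i) (P * Q)" for p
    by (simp add: eval_poly_mult P Q)
  ultimately show ?thesis
    unfolding config_polynomials_def using P(1) Q(1)
    by (intro CollectI exI[of _ "P * Q"]) blast
qed

text \<open>A polynomial function that is nonzero at a single configuration comes from a nonzero
  polynomial, and generic configurations are no zeros of such a polynomial.\<close>
lemma generic_nonvanishing:
  assumes "generic d V p" "g \<in> config_polynomials d V" "g q \<noteq> 0"
  shows "g p \<noteq> 0"
proof -
  obtain P where P: "poly_vars P \<subseteq> V \<times> {..<d}" "\<And>p. g p = eval_poly (\<lambda>(v, i). p v i) P"
    using assms(2) unfolding config_polynomials_def by blast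
  have "P \<noteq> 0" using assms(3) P(2)[of q] by (auto simp: eval_poly_def)
  then show ?thesis using assms(1) P unfolding generic_def by metis
qed

lemma generic_row_independent:
  fixes M :: "'e \<Rightarrow> 'j \<Rightarrow> ('v \<Rightarrow> nat \<Rightarrow> complex) \<Rightarrow> complex"
  assumes "generic d V p" "finite F"
    and "\<And>e j. e \<in> F \<Longrightarrow> j \<in> J \<Longrightarrow> M e j \<in> config_polynomials d V"
    and "row_independent J (\<lambda>e j. M e j q) F"
  shows "row_independent J (\<lambda>e j. M e j p) F"
proof -
  have "\<forall>\<^sub>F p' in principal {p}. row_independent J (\<lambda>e j. M e j p') F"
  proof (rule row_independent_persists[where R = "config_polynomials d V" and q = q])
    fix g :: "('v \<Rightarrow> nat \<Rightarrow> complex) \<Rightarrow> complex"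
    assume "g \<in> config_polynomials d V" "g q \<noteq> 0"
    then show "\<forall>\<^sub>F p' in principal {p}. g p' \<noteq> 0"
      using generic_nonvanishing[OF assms(1)] by (simp add: eventually_principal)
  qed (use assms(2,3,4) in \<open>auto intro: config_polynomials_diff config_polynomials_mult\<close>)
  then show ?thesis by (simp add: eventually_principal)
qed

lemma generic_mono: "generic d V p \<Longrightarrow> V' \<subseteq> V \<Longrightarrow> generic d V' p"
  unfolding generic_def by (meson Sigma_mono order_refl order_trans)

text \<open>Exponents are plain functions, required elsewhere to vanish outside \<open>X\<close>, so that a
  variable is removed from a monomial by the update \<open>m(x := 0)\<close>.\<close>
definition monomial_value :: "'x set \<Rightarrow> ('x \<Rightarrow> complex) \<Rightarrow> ('x \<Rightarrow> nat) \<Rightarrow> complex" where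
  "monomial_value X f m = (\<Prod>x\<in>X. f x ^ m x)"

text \<open>Algebraic independence over the rationals, phrased as linear independence of the monomials:
  the coefficients of a polynomial with respect to one variable are then sums over subsets of
  \<open>M\<close>.\<close>
definition algebraically_independent :: "'x set \<Rightarrow> ('x \<Rightarrow> complex) \<Rightarrow> bool" where
  "algebraically_independent X f \<longleftrightarrow>
     (\<forall>M c. finite M \<and> (\<forall>m\<in>M. \<forall>x. x \<notin> X \<longrightarrow> m x = 0) \<and> (\<exists>m\<in>M. c m \<noteq> 0) \<longrightarrow>
       (\<Sum>m\<in>M. of_rat (c m) * monomial_value X f m) \<noteq> 0)"

text \<open>Sort the monomials by their exponent of \<open>x\<close>. The coefficient of \<open>x\<close> to the
  power \<open>m0 x\<close> contains the monomial \<open>m0\<close>, so it is nonzero by the independence of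
  the other values, and a nonzero polynomial in one variable has finitely many roots.\<close>
lemma finite_roots_last_variable:
  assumes "finite X" "x \<notin> X" "algebraically_independent X f"
    and M: "finite M" "\<forall>m\<in>M. \<forall>y. y \<notin> insert x X \<longrightarrow> m y = 0" "m0 \<in> M" "c m0 \<noteq> 0"
  shows "finite {z. (\<Sum>m\<in>M. of_rat (c m) * monomial_value (insert x X) (f(x := z)) m) = 0}"
proof -
  define n where "n = Max ((\<lambda>m. m x) ` M)"
  have n: "m x \<le> n" if "m \<in> M" for m
    unfolding n_def using that M(1) by simp
  define a where "a k = (\<Sum>m | m \<in> M \<and> m x = k. of_rat (c m) * monomial_value X f m)" for k
  have mv: "monomial_value (insert x X) (f(x := z)) m = z ^ m x * monomial_value X f m" for z m
  proof -
    have "(\<Prod>y\<in>X. (f(x := z)) y ^ m y) = (\<Prod>y\<in>X. f y ^ m y)"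
      using assms(2) by (intro prod.cong) auto
    then show ?thesis unfolding monomial_value_def using assms(1,2) by simp
  qed
  have "(\<Sum>m\<in>M. of_rat (c m) * monomial_value (insert x X) (f(x := z)) m) =
      (\<Sum>k\<le>n. a k * z ^ k)" for z
  proof -
    have "(\<Sum>k\<le>n. a k * z ^ k) =
        (\<Sum>k\<le>n. \<Sum>m | m \<in> M \<and> m x = k. of_rat (c m) * monomial_value X f m * z ^ m x)"
      unfolding a_def by (simp add: sum_distrib_right)
    also have "\<dots> = (\<Sum>m\<in>M. of_rat (c m) * monomial_value X f m * z ^ m x)"
      using n by (intro sum.group[OF M(1)]) auto
    finally show ?thesis by (simp add: mv mult_ac)
  qed
  moreover have "a (m0 x) \<noteq> 0"
  proof -
    \<comment> \<open>Distinct monomials with the same exponent of the variable x remain distinct when x is removed.\<close>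
    define N where "N = {m \<in> M. m x = m0 x}"
    let ?r = "\<lambda>m. m(x := 0::nat)"
    have inj: "inj_on ?r N"
    proof (rule inj_onI)
      fix m m' assume "m \<in> N" "m' \<in> N" and eq: "?r m = ?r m'"
      then have "m x = m' x" by (simp add: N_def)
      show "m = m'"
      proof
        fix y
        show "m y = m' y" using \<open>m x = m' x\<close> fun_cong[OF eq, of y] by (cases "y = x") auto
      qed
    qed
    have "monomial_value X f (?r m) = monomial_value X f m" for m
      unfolding monomial_value_def using assms(2) by (intro prod.cong) auto
    then have "a (m0 x) = (\<Sum>m\<in>?r ` N. of_rat (c (the_inv_into N ?r m)) * monomial_value X f m)"
      unfolding a_def N_def[symmetric]
      by (simp add: sum.reindex[OF inj] the_inv_into_f_f[OF inj])
    moreover have "finite (?r ` N)" "\<forall>m\<in>?r ` N. \<forall>y. y \<notin> X \<longrightarrow> m y = 0"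
      using M(1,2) by (auto simp: N_def)
    moreover have "m0 \<in> N" using M(3) by (simp add: N_def)
    then have "\<exists>m\<in>?r ` N. c (the_inv_into N ?r m) \<noteq> 0"
      using M(4) the_inv_into_f_f[OF inj] by force
    ultimately show ?thesis
      using assms(3) unfolding algebraically_independent_def by simp
  qed
  then have "finite {z. (\<Sum>k\<le>n. a k * z ^ k) = 0}"
    using polyfun_finite_roots[of a n] n[OF M(3)] by blast
  ultimately show ?thesis by simp
qed

lemma countable_finitely_supported:
  fixes A :: "'a set" and B :: "'b set"
  assumes "countable A" "countable B"
  shows "countable {g. finite {x. g x \<noteq> b} \<and> {x. g x \<noteq> b} \<subseteq> A \<and> g ` A \<subseteq> B}"
proof -
  let ?G = "{g :: 'a \<Rightarrow> 'b. finite {x. g x \<noteq> b} \<and> {x. g x \<noteq> b} \<subseteq> A \<and> g ` A \<subseteq> B}"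
  let ?h = "\<lambda>g :: 'a \<Rightarrow> 'b. (\<lambda>x. (x, g x)) ` {x. g x \<noteq> b}"
  have "inj_on ?h ?G"
  proof (rule inj_onI)
    fix g g' :: "'a \<Rightarrow> 'b"
    assume eq: "?h g = ?h g'"
    show "g = g'"
    proof
      fix x
      have "(x, y) \<in> ?h k \<longleftrightarrow> y = k x \<and> k x \<noteq> b" for y k by auto
      then show "g x = g' x" using eq by metis
    qed
  qed
  moreover have "countable (?h ` ?G)"
  proof (rule countable_subset)
    show "?h ` ?G \<subseteq> {S. S \<subseteq> A \<times> B \<and> finite S}" by auto
    show "countable {S. S \<subseteq> A \<times> B \<and> finite S}"
      using countable_Collect_finite_subset[of "A \<times> B"] assms
      by (simp add: conj_commute)
  qed
  ultimately show ?thesis by (meson countable_image_inj_on)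
qed

text \<open>Values are chosen one variable at a time. There are countably many rational polynomials and
  each of them excludes finitely many values, so an admissible complex number remains.\<close>
lemma exists_algebraically_independent:
  fixes X :: "'x set"
  assumes "finite X"
  shows "\<exists>f. algebraically_independent X f"
  using assms
proof (induction X rule: finite_induct)
  case empty
  have "algebraically_independent {} (\<lambda>_ :: 'x. 0)"
    unfolding algebraically_independent_def
  proof (intro allI impI)
    fix M and c :: "('x \<Rightarrow> nat) \<Rightarrow> rat"
    assume *: "finite M \<and> (\<forall>m\<in>M. \<forall>x. x \<notin> {} \<longrightarrow> m x = 0) \<and> (\<exists>m\<in>M. c m \<noteq> 0)"
    then obtain m where m: "m \<in> M" "c m \<noteq> 0" by blast
    have "m' = m" if "m' \<in> M" for m' using * that m(1) by (metis ext empty_iff)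
    then have "M = {m}" using m(1) by blast
    then show "(\<Sum>m\<in>M. of_rat (c m) * monomial_value {} (\<lambda>_. 0) m) \<noteq> 0"
      using m(2) by (simp add: monomial_value_def)
  qed
  then show ?case by blast
next
  case (insert x X)
  then obtain f where f: "algebraically_independent X f" by blast
  define Mon where "Mon = {m. finite {y. m y \<noteq> (0::nat)} \<and> {y. m y \<noteq> 0} \<subseteq> insert x X \<and> m ` insert x X \<subseteq> UNIV}"
  define Pol where "Pol = {c. finite {m. c m \<noteq> (0::rat)} \<and> {m. c m \<noteq> 0} \<subseteq> Mon \<and> c ` Mon \<subseteq> UNIV}"
  have "countable Mon" unfolding Mon_def
    using insert.hyps(1) by (intro countable_finitely_supported) (auto intro: countable_finite)
  then have Pol: "countable Pol" unfolding Pol_def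
    by (intro countable_finitely_supported) auto
  define Z where "Z c = {z. (\<Sum>m | c m \<noteq> 0. of_rat (c m) * monomial_value (insert x X) (f(x := z)) m) = 0}" for c
  have "finite (Z c)" if c: "c \<in> Pol - {\<lambda>_. 0}" for c
  proof -
    obtain m0 where "c m0 \<noteq> 0" using c by (auto simp: fun_eq_iff)
    then show ?thesis unfolding Z_def
      using c insert.hyps
      by (intro finite_roots_last_variable[OF _ _ f, where ?m0.0 = m0]) (auto simp: Pol_def Mon_def)
  qed
  then have "countable (\<Union>c\<in>Pol - {\<lambda>_. 0}. Z c)"
    using Pol by (intro countable_UN) (auto intro: countable_finite)
  then obtain z where z: "z \<notin> (\<Union>c\<in>Pol - {\<lambda>_. 0}. Z c)"
    using uncountable_UNIV_complex by (metis UNIV_eq_I)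
  have "algebraically_independent (insert x X) (f(x := z))"
    unfolding algebraically_independent_def
  proof (intro allI impI)
    fix M and c :: "('x \<Rightarrow> nat) \<Rightarrow> rat"
    assume *: "finite M \<and> (\<forall>m\<in>M. \<forall>y. y \<notin> insert x X \<longrightarrow> m y = 0) \<and> (\<exists>m\<in>M. c m \<noteq> 0)"
    define c' where "c' m = (if m \<in> M then c m else 0)" for m
    have sub: "{m. c' m \<noteq> 0} \<subseteq> M" by (auto simp: c'_def)
    have "M \<subseteq> Mon"
    proof
      fix m assume "m \<in> M"
      with * have "\<forall>y. y \<notin> insert x X \<longrightarrow> m y = 0" by (elim conjE bspec)
      then have "{y. m y \<noteq> 0} \<subseteq> insert x X"
        by (intro subsetI) (metis mem_Collect_eq)
      then show "m \<in> Mon" using insert.hyps(1) by (simp add: Mon_def finite_subset)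
    qed
    moreover have "finite {m. c' m \<noteq> 0}" using * finite_subset[OF sub] by blast
    ultimately have "c' \<in> Pol" using sub by (simp add: Pol_def)
    moreover have "c' \<noteq> (\<lambda>_. 0)" using * unfolding c'_def by metis
    ultimately have "c' \<in> Pol - {\<lambda>_. 0}" by simp
    with z have "z \<notin> Z c'" by blast
    moreover have "(\<Sum>m | c' m \<noteq> 0. of_rat (c' m) * monomial_value (insert x X) (f(x := z)) m) =
        (\<Sum>m\<in>M. of_rat (c m) * monomial_value (insert x X) (f(x := z)) m)"
      using conjunct1[OF *] sub by (intro sum.mono_neutral_cong_left) (auto simp: c'_def)
    ultimately show "(\<Sum>m\<in>M. of_rat (c m) * monomial_value (insert x X) (f(x := z)) m) \<noteq> 0"
      by (simp add: Z_def)
  qed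
  then show ?case by blast
qed

lemma exists_generic:
  assumes "finite V"
  shows "\<exists>p. generic d V p"
proof -
  let ?X = "V \<times> {..<d}"
  have fin: "finite ?X" using assms by simp
  then obtain f where f: "algebraically_independent ?X f"
    using exists_algebraically_independent by blast
  have "generic d V (\<lambda>v i. f (v, i))"
    unfolding generic_def
  proof (intro allI impI)
    fix P :: "(('a \<times> nat) \<Rightarrow>\<^sub>0 nat) \<Rightarrow>\<^sub>0 rat"
    assume P: "P \<noteq> 0 \<and> poly_vars P \<subseteq> ?X"
    have inj: "inj_on Poly_Mapping.lookup (Poly_Mapping.keys P)"
      by (auto simp: inj_on_def poly_mapping.lookup_inject)
    let ?c = "\<lambda>m. Poly_Mapping.lookup P (the_inv_into (Poly_Mapping.keys P) Poly_Mapping.lookup m)"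
    have sub: "Poly_Mapping.keys m \<subseteq> ?X" if "m \<in> Poly_Mapping.keys P" for m
      using that P unfolding poly_vars_def by blast
    have "monomial_value ?X f (Poly_Mapping.lookup m) =
        (\<Prod>x\<in>Poly_Mapping.keys m. f x ^ Poly_Mapping.lookup m x)"
      if "m \<in> Poly_Mapping.keys P" for m
      unfolding monomial_value_def using fin sub[OF that]
      by (intro prod.mono_neutral_right) (auto simp: in_keys_iff)
    then have "eval_poly f P =
        (\<Sum>m\<in>Poly_Mapping.lookup ` Poly_Mapping.keys P. of_rat (?c m) * monomial_value ?X f m)"
      by (simp add: eval_poly_def sum.reindex[OF inj] the_inv_into_f_f[OF inj])
    moreover have "Poly_Mapping.keys P \<noteq> {}"
      using P by simp
    then have "\<exists>m\<in>Poly_Mapping.lookup ` Poly_Mapping.keys P. ?c m \<noteq> 0"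
      using the_inv_into_f_f[OF inj] in_keys_iff[of _ P] by fastforce
    moreover have "\<forall>m\<in>Poly_Mapping.lookup ` Poly_Mapping.keys P. \<forall>x. x \<notin> ?X \<longrightarrow> m x = 0"
    proof (intro ballI allI impI)
      fix m x assume "m \<in> Poly_Mapping.lookup ` Poly_Mapping.keys P" "x \<notin> ?X"
      then show "m x = 0" using sub by (metis image_iff in_keys_iff subsetD)
    qed
    ultimately have "eval_poly f P \<noteq> 0"
      using f unfolding algebraically_independent_def by simp
    then show "eval_poly (\<lambda>(v, i). f (v, i)) P \<noteq> 0" by simp
  qed
  then show ?thesis by blast
qed

section \<open>Infinitesimal motions and rigidity\<close>
lemma complete_edgesE:
  assumes "e \<in> complete_edges V"
  obtains a b where "e = {a, b}" "a \<in> V" "b \<in> V" "a \<noteq> b"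
  using assms unfolding complete_edges_def by blast

lemma complete_edges_mono: "V \<subseteq> W \<Longrightarrow> complete_edges V \<subseteq> complete_edges W"
  unfolding complete_edges_def by blast

lemma finite_edge_set: "finite V \<Longrightarrow> F \<subseteq> complete_edges V \<Longrightarrow> finite F"
  by (rule finite_subset[of _ "Pow V"]) (auto simp: complete_edges_def)

lemma doubleton_mem_complete_edges:
  "{a, b} \<in> complete_edges V \<longleftrightarrow> a \<in> V \<and> b \<in> V \<and> a \<noteq> b"
  unfolding complete_edges_def by (auto simp: doubleton_eq_iff)

lemma measurement_edge: "measurement d p {a, b} = (\<Sum>i<d. (p a i - p b i)\<^sup>2)"
  unfolding measurement_def
  by (rule the_equality) (auto simp: doubleton_eq_iff power2_commute)

lemma jacobian_endpoint:
  assumes "a \<noteq> b" "i < d"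
  shows "jacobian d p {a, b} a i = 2 * (p a i - p b i)"
proof -
  let ?K = "\<Sum>j\<in>{..<d} - {i}. (p a j - p b j)\<^sup>2"
  have "measurement d (p(a := (p a)(i := z))) {a, b} = (z - p b i)\<^sup>2 + ?K" for z
  proof -
    have "measurement d (p(a := (p a)(i := z))) {a, b} =
        (\<Sum>j<d. (((p a)(i := z)) j - p b j)\<^sup>2)"
      using assms(1) by (simp add: measurement_edge)
    also have "\<dots> = (((p a)(i := z)) i - p b i)\<^sup>2 +
        (\<Sum>j\<in>{..<d} - {i}. (((p a)(i := z)) j - p b j)\<^sup>2)"
      using assms(2) by (intro sum.remove) auto
    also have "(\<Sum>j\<in>{..<d} - {i}. (((p a)(i := z)) j - p b j)\<^sup>2) = ?K"
      by (intro sum.cong) auto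
    finally show ?thesis by (simp only: fun_upd_same)
  qed
  then have "jacobian d p {a, b} a i = deriv (\<lambda>z. (z - p b i)\<^sup>2 + ?K) (p a i)"
    unfolding jacobian_def by presburger
  also have "\<dots> = 2 * (p a i - p b i)"
    by (rule DERIV_imp_deriv) (auto intro!: derivative_eq_intros)
  finally show ?thesis .
qed

lemma jacobian_edge:
  assumes "a \<noteq> b" "i < d"
  shows "jacobian d p {a, b} w i =
    (if w = a then 2 * (p a i - p b i) else if w = b then 2 * (p b i - p a i) else 0)"
proof -
  have "jacobian d p {a, b} b i = 2 * (p b i - p a i)"
    using jacobian_endpoint[of b a i d p] assms by (simp add: insert_commute)
  moreover have "jacobian d p {a, b} w i = 0" if "w \<noteq> a" "w \<noteq> b"
    unfolding jacobian_def measurement_edge using that by simp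
  ultimately show ?thesis using jacobian_endpoint[OF assms] by auto
qed

text \<open>The product of the Jacobian row of \<open>e\<close> with a velocity field \<open>x\<close>, that is,
  the rate at which the squared length of \<open>e\<close> changes. Only the endpoints of \<open>e\<close>
  contribute, so no vertex set enters.\<close>
definition strain ::
  "nat \<Rightarrow> ('v \<Rightarrow> nat \<Rightarrow> complex) \<Rightarrow> ('v \<Rightarrow> nat \<Rightarrow> complex) \<Rightarrow> 'v set \<Rightarrow> complex" where
  "strain d p x e = (\<Sum>w\<in>e. \<Sum>i<d. jacobian d p e w i * x w i)"

lemma strain_edge:
  assumes "a \<noteq> b"
  shows "strain d p x {a, b} = 2 * (\<Sum>i<d. (p a i - p b i) * (x a i - x b i))"
proof -
  have "strain d p x {a, b} =
      (\<Sum>i<d. 2 * (p a i - p b i) * x a i) + (\<Sum>i<d. 2 * (p b i - p a i) * x b i)"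
    unfolding strain_def using assms by (simp add: jacobian_edge)
  then show ?thesis
    by (simp add: sum_distrib_left algebra_simps flip: sum.distrib)
qed

lemma strain_eq_row_times_velocity:
  assumes "finite V" "e \<in> complete_edges V"
  shows "(\<Sum>(w, i)\<in>V \<times> {..<d}. jacobian d p e w i * x w i) = strain d p x e"
proof -
  obtain a b where e: "e = {a, b}" "a \<in> V" "b \<in> V" "a \<noteq> b"
    using assms(2) by (rule complete_edgesE)
  have "strain d p x e = (\<Sum>w\<in>V. \<Sum>i<d. jacobian d p e w i * x w i)"
    unfolding strain_def using assms(1) e
    by (intro sum.mono_neutral_left) (auto simp: jacobian_edge)
  then show ?thesis by (simp add: sum.cartesian_product)
qed

lemma rows_independent_iff:
  "rows_independent d V p F \<longleftrightarrow>
     row_independent (V \<times> {..<d}) (\<lambda>e (w, i). jacobian d p e w i) F"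
  unfolding rows_independent_def row_independent_def by auto

lemma generic_rows_independent:
  assumes "generic d V p" "finite V" "F \<subseteq> complete_edges V" "rows_independent d V q F"
  shows "rows_independent d V p F"
proof -
  have "(\<lambda>p. case j of (w, i) \<Rightarrow> jacobian d p e w i) \<in> config_polynomials d V"
    if e: "e \<in> F" and j: "j \<in> V \<times> {..<d}" for e j
  proof -
    obtain a b where ab: "e = {a, b}" "a \<in> V" "b \<in> V" "a \<noteq> b"
      using e assms(3) by (blast elim: complete_edgesE)
    obtain w i where wi: "j = (w, i)" "w \<in> V" "i < d" using j by blast
    have dif: "(\<lambda>p. p u i - p v i) \<in> config_polynomials d V" if "u \<in> V" "v \<in> V" for u v
      using that wi by (intro config_polynomials_diff config_polynomials_coordinate)
    have twice: "(\<lambda>p. 2 * (p u i - p v i)) \<in> config_polynomials d V" if "u \<in> V" "v \<in> V" for u v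
    proof -
      have "2 * (p u i - p v i) = (p u i - p v i) - (p v i - p u i)"
        for p :: "'a \<Rightarrow> nat \<Rightarrow> complex"
        by simp
      then show ?thesis
        using config_polynomials_diff[OF dif[OF that] dif[OF that(2,1)]] by simp
    qed
    show ?thesis
      unfolding wi(1) ab(1) using dif[OF wi(2) wi(2)] twice ab wi(3)
      by (cases "w = a"; cases "w = b")
        (simp_all add: jacobian_edge del: right_diff_distrib_numeral)
  qed
  then show ?thesis
    unfolding rows_independent_iff
    using generic_row_independent[OF assms(1) finite_edge_set[OF assms(2,3)],
        of "V \<times> {..<d}" "\<lambda>e j p. case j of (w, i) \<Rightarrow> jacobian d p e w i" q]
      assms(4)[unfolded rows_independent_iff]
    by blast
qed

lemma continuous_rows_independent:
  fixes q :: "complex \<Rightarrow> 'v \<Rightarrow> nat \<Rightarrow> complex"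
  assumes "\<And>w i. w \<in> V \<Longrightarrow> i < d \<Longrightarrow> isCont (\<lambda>t. q t w i) t0"
    and "finite V" "F \<subseteq> complete_edges V" "rows_independent d V (q t0) F"
  shows "\<forall>\<^sub>F t in at t0. rows_independent d V (q t) F"
  unfolding rows_independent_iff
proof (rule row_independent_persists[where R = "{g. isCont g t0}" and q = t0])
  show "finite F" using assms(2,3) by (rule finite_edge_set)
  show "\<forall>\<^sub>F t in at t0. g t \<noteq> 0" if "g \<in> {g. isCont g t0}" "g t0 \<noteq> 0" for g :: "complex \<Rightarrow> complex"
    using that tendsto_imp_eventually_ne[of g "g t0" "at t0" 0] by (simp add: isCont_def)
  show "(\<lambda>t. case j of (w, i) \<Rightarrow> jacobian d (q t) e w i) \<in> {g. isCont g t0}"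
    if e: "e \<in> F" and j: "j \<in> V \<times> {..<d}" for e j
  proof -
    obtain a b where ab: "e = {a, b}" "a \<in> V" "b \<in> V" "a \<noteq> b"
      using e assms(3) by (blast elim: complete_edgesE)
    obtain w i where wi: "j = (w, i)" "w \<in> V" "i < d" using j by blast
    have "isCont (\<lambda>t. 2 * (q t u i - q t v i)) t0" if "u \<in> V" "v \<in> V" for u v
      using isCont_mult[OF continuous_const isCont_diff[OF assms(1)[OF that(1) wi(3)]
          assms(1)[OF that(2) wi(3)]], of 2] .
    then show ?thesis
      unfolding wi(1) ab(1) using ab wi(3)
      by (cases "w = a"; cases "w = b")
        (simp_all add: jacobian_edge del: right_diff_distrib_numeral)
  qed
  show "row_independent (V \<times> {..<d}) (\<lambda>e j. case j of (w, i) \<Rightarrow> jacobian d (q t0) e w i) F"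
    using assms(4) by (simp add: rows_independent_iff)
qed auto

definition infinitesimal_motion ::
  "nat \<Rightarrow> ('v \<Rightarrow> nat \<Rightarrow> complex) \<Rightarrow> 'v set set \<Rightarrow> ('v \<Rightarrow> nat \<Rightarrow> complex) \<Rightarrow> bool" where
  "infinitesimal_motion d p F x \<longleftrightarrow> (\<forall>e\<in>F. strain d p x e = 0)"

lemma infinitesimal_motion_mono:
  "infinitesimal_motion d p F x \<Longrightarrow> F' \<subseteq> F \<Longrightarrow> infinitesimal_motion d p F' x"
  unfolding infinitesimal_motion_def by blast

text \<open>The next two lemmas are the two halves of linear duality: an edge row lies in the span of
  independent rows exactly if every motion that annihilates these rows annihilates it too.\<close>
lemma motion_straining_independent_edge:
  assumes "finite V" "insert e B \<subseteq> complete_edges V" "e \<notin> B"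
    and "rows_independent d V p (insert e B)"
  obtains x where "infinitesimal_motion d p B x" "strain d p x e \<noteq> 0"
proof -
  let ?J = "V \<times> {..<d}"
  have "finite (insert e B)"
    using assms(1,2) by (rule finite_edge_set)
  moreover have "finite ?J" using assms(1) by simp
  ultimately have "\<exists>y. \<forall>f\<in>insert e B.
      (\<Sum>j\<in>?J. (case j of (w, i) \<Rightarrow> jacobian d p f w i) * y j) = (if f = e then 1 else 0)"
    using assms(4)[unfolded rows_independent_iff] by (rule row_independent_solve)
  then obtain y where y: "\<forall>f\<in>insert e B.
      (\<Sum>j\<in>?J. (case j of (w, i) \<Rightarrow> jacobian d p f w i) * y j) = (if f = e then 1 else 0)"
    by (elim exE)
  have "strain d p (\<lambda>w i. y (w, i)) f = (if f = e then 1 else 0)" if "f \<in> insert e B" for f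
  proof -
    have "strain d p (\<lambda>w i. y (w, i)) f = (\<Sum>(w, i)\<in>?J. jacobian d p f w i * y (w, i))"
      using strain_eq_row_times_velocity[OF assms(1) subsetD[OF assms(2) that], symmetric] .
    also have "\<dots> = (\<Sum>j\<in>?J. (case j of (w, i) \<Rightarrow> jacobian d p f w i) * y j)"
      by (intro sum.cong) auto
    finally show ?thesis using bspec[OF y that] by simp
  qed
  then show thesis
    using assms(3) by (intro that[of "\<lambda>w i. y (w, i)"]) (auto simp: infinitesimal_motion_def)
qed

lemma motion_preserves_dependent_edge:
  assumes "finite V" "insert e B \<subseteq> complete_edges V" "e \<notin> B"
    and "rows_independent d V p B" "\<not> rows_independent d V p (insert e B)"
    and "infinitesimal_motion d p B x"
  shows "strain d p x e = 0"
proof -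
  let ?J = "V \<times> {..<d}"
  have fin: "finite B" using finite_edge_set[OF assms(1,2)] by simp
  obtain c where c: "\<And>w i. (w, i) \<in> ?J \<Longrightarrow> jacobian d p e w i = (\<Sum>f\<in>B. c f * jacobian d p f w i)"
    using row_dependent_insert[OF fin assms(3) assms(4,5)[unfolded rows_independent_iff]] by force
  have "strain d p x e = (\<Sum>(w, i)\<in>?J. jacobian d p e w i * x w i)"
    using strain_eq_row_times_velocity[OF assms(1), of e] assms(2) by simp
  also have "\<dots> = (\<Sum>(w, i)\<in>?J. \<Sum>f\<in>B. c f * (jacobian d p f w i * x w i))"
    by (intro sum.cong refl) (clarsimp simp: c sum_distrib_left sum_distrib_right mult_ac)
  also have "\<dots> = (\<Sum>f\<in>B. c f * (\<Sum>(w, i)\<in>?J. jacobian d p f w i * x w i))"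
    by (simp add: case_prod_unfold sum_distrib_left sum.swap[of _ ?J])
  also have "\<dots> = (\<Sum>f\<in>B. c f * strain d p x f)"
    using strain_eq_row_times_velocity[OF assms(1)] assms(2) by (intro sum.cong) auto
  also have "\<dots> = 0" using assms(6) by (simp add: infinitesimal_motion_def)
  finally show ?thesis .
qed

lemma exists_maximal_independent_rows:
  assumes "finite F"
  obtains B where "B \<subseteq> F" "rows_independent d V p B"
    "\<And>e. e \<in> F - B \<Longrightarrow> \<not> rows_independent d V p (insert e B)"
proof -
  let ?S = "{B. B \<subseteq> F \<and> rows_independent d V p B}"
  have "finite ?S" by (rule finite_subset[of _ "Pow F"]) (use assms in auto)
  moreover have "{} \<in> ?S" by (simp add: rows_independent_def)
  then have "?S \<noteq> {}" by (rule ex_in_conv[THEN iffD1, OF exI])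
  ultimately have "\<exists>B\<in>?S. \<forall>B'\<in>?S. B \<subseteq> B' \<longrightarrow> B = B'"
    by (rule finite_has_maximal)
  then obtain B where B: "B \<in> ?S" and max: "\<forall>B'\<in>?S. B \<subseteq> B' \<longrightarrow> B = B'"
    by (elim bexE)
  show thesis
  proof (rule that)
    show "\<not> rows_independent d V p (insert e B)" if "e \<in> F - B" for e
      using bspec[OF max, of "insert e B"] B that by auto
  qed (use B in auto)
qed

text \<open>Independence at one configuration implies independence at every generic one, so a single
  generic configuration decides membership.\<close>
lemma rigidity_matroid_iff:
  assumes "finite V" "generic d V p"
  shows "F \<in> rigidity_matroid d V (complete_edges V) \<longleftrightarrow>
    F \<subseteq> complete_edges V \<and> rows_independent d V p F"
  unfolding rigidity_matroid_def
  using generic_rows_independent[of d V _ F p] assms by blast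

text \<open>The span of the rows of \<open>E\<close> contains all rows of the complete graph exactly if the
  two sets of rows have the same annihilator. From here on rigidity is a statement about motions at
  one fixed generic configuration.\<close>
lemma d_rigid_iff_motions:
  assumes "finite V" "generic d V p" "E \<subseteq> complete_edges V"
  shows "d_rigid d V E \<longleftrightarrow>
    (\<forall>x. infinitesimal_motion d p E x \<longrightarrow> infinitesimal_motion d p (complete_edges V) x)"
proof
  assume "d_rigid d V E"
  then obtain B where B: "B \<subseteq> E"
    "B \<in> rigidity_matroid d V (complete_edges V)"
    "\<And>B'. B' \<in> rigidity_matroid d V (complete_edges V) \<Longrightarrow> B \<subseteq> B' \<Longrightarrow> B' = B"
    unfolding d_rigid_def matroid_spanning_def matroid_basis_def by blast
  show "\<forall>x. infinitesimal_motion d p E x \<longrightarrow> infinitesimal_motion d p (complete_edges V) x"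
  proof (intro allI impI)
    fix x assume x: "infinitesimal_motion d p E x"
    then have xB: "infinitesimal_motion d p B x" using B(1) infinitesimal_motion_mono by blast
    have "strain d p x e = 0" if e: "e \<in> complete_edges V" for e
    proof (cases "e \<in> B")
      case True
      then show ?thesis using xB by (simp add: infinitesimal_motion_def)
    next
      case False
      then have "insert e B \<notin> rigidity_matroid d V (complete_edges V)" using B(3) by blast
      then show ?thesis
        using motion_preserves_dependent_edge[OF assms(1) _ False _ _ xB]
          rigidity_matroid_iff[OF assms(1,2)] B(2) e
        by (metis insert_subset)
    qed
    then show "infinitesimal_motion d p (complete_edges V) x"
      by (simp add: infinitesimal_motion_def)
  qed
next
  assume R: "\<forall>x. infinitesimal_motion d p E x \<longrightarrow> infinitesimal_motion d p (complete_edges V) x"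
  have "finite E" using assms(1,3) by (rule finite_edge_set)
  then obtain B where B: "B \<subseteq> E" "rows_independent d V p B"
    "\<And>e. e \<in> E - B \<Longrightarrow> \<not> rows_independent d V p (insert e B)"
    by (rule exists_maximal_independent_rows[where d = d and V = V and p = p]) blast
  have "B' = B" if B': "B' \<in> rigidity_matroid d V (complete_edges V)" "B \<subseteq> B'" for B'
  proof (rule ccontr)
    assume "B' \<noteq> B"
    then obtain e where e: "e \<in> B'" "e \<notin> B" using B'(2) by blast
    have sub: "insert e B \<subseteq> complete_edges V" "finite B'"
      using B' e rigidity_matroid_iff[OF assms(1,2)] finite_edge_set[OF assms(1)]
      by blast+
    have "rows_independent d V p (insert e B)"
      using B' e rigidity_matroid_iff[OF assms(1,2)] row_independent_mono[OF sub(2)]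
      unfolding rows_independent_iff by blast
    then obtain x where x: "infinitesimal_motion d p B x" "strain d p x e \<noteq> 0"
      using motion_straining_independent_edge[OF assms(1) sub(1) e(2)] by blast
    have "strain d p x f = 0" if "f \<in> E" for f
    proof (cases "f \<in> B")
      case True
      then show ?thesis using x(1) by (simp add: infinitesimal_motion_def)
    next
      case False
      then show ?thesis
        using motion_preserves_dependent_edge[OF assms(1) _ False B(2) B(3) x(1)] that assms(3) B(1)
        by blast
    qed
    then have "infinitesimal_motion d p (complete_edges V) x"
      using R by (simp add: infinitesimal_motion_def)
    then show False using x(2) sub(1) by (simp add: infinitesimal_motion_def)
  qed
  moreover have "B \<in> rigidity_matroid d V (complete_edges V)"
    using rigidity_matroid_iff[OF assms(1,2)] B(1,2) assms(3) by blast
  ultimately show "d_rigid d V E"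
    unfolding d_rigid_def matroid_spanning_def matroid_basis_def using B(1) by blast
qed

section \<open>Gluing rigid graphs along d vertices\<close>
text \<open>Some special configuration puts the points of \<open>T\<close> at distinct unit vectors and
  \<open>s0\<close> at the origin; generic configurations inherit the independence.\<close>
lemma generic_rows_affinely_independent:
  assumes "generic d V p" "s0 \<in> V" "T \<subseteq> V" "s0 \<notin> T" "finite T" "card T \<le> d"
  shows "row_independent {..<d} (\<lambda>s j. p s j - p s0 j) T"
proof -
  obtain h where h: "inj_on h T" "h ` T \<subseteq> {..<d}"
    using card_le_inj[OF assms(5), of "{..<d}"] assms(6) by auto
  define q :: "'a \<Rightarrow> nat \<Rightarrow> complex" where "q s j = (if s \<in> T \<and> j = h s then 1 else 0)" for s j
  have "row_independent {..<d} (\<lambda>s j. q s j - q s0 j) T"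
    unfolding row_independent_def
  proof (intro allI impI ballI)
    fix c s assume c: "\<forall>j\<in>{..<d}. (\<Sum>s\<in>T. c s * (q s j - q s0 j)) = 0" and s: "s \<in> T"
    have "(\<Sum>r\<in>T. c r * (q r (h s) - q s0 (h s))) = (\<Sum>r\<in>T. if r = s then c r else 0)"
      using h(1) s assms(4) by (intro sum.cong) (auto simp: q_def inj_on_def)
    also have "\<dots> = c s" using s assms(5) by simp
    finally show "c s = 0" using c h(2) s by (metis image_subset_iff)
  qed
  moreover have "(\<lambda>p. p s j - p s0 j) \<in> config_polynomials d V" if "s \<in> T" "j \<in> {..<d}" for s j
    using that assms(2,3) by (intro config_polynomials_diff config_polynomials_coordinate) auto
  ultimately show ?thesis
    by (intro generic_row_independent[OF assms(1,5), where M = "\<lambda>s j p. p s j - p s0 j" and q = q])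
qed

text \<open>The same special configuration gives an identity matrix, so the transposed rows are
  independent as well and the differences to \<open>s0\<close> span the whole space.\<close>
lemma generic_affine_combination:
  assumes "generic d V p" "s0 \<in> V" "T \<subseteq> V" "s0 \<notin> T" "finite T" "card T = d"
  shows "\<exists>\<alpha>. \<forall>j\<in>{..<d}. (\<Sum>s\<in>T. (p s j - p s0 j) * \<alpha> s) = b j"
proof -
  obtain h where h: "bij_betw h T {..<d}"
    using finite_same_card_bij[OF assms(5), of "{..<d}"] assms(6) by auto
  define q :: "'a \<Rightarrow> nat \<Rightarrow> complex" where "q s j = (if s \<in> T \<and> j = h s then 1 else 0)" for s j
  have "row_independent T (\<lambda>j s. q s j - q s0 j) {..<d}"
    unfolding row_independent_def
  proof (intro allI impI ballI)
    fix c j assume c: "\<forall>s\<in>T. (\<Sum>j\<in>{..<d}. c j * (q s j - q s0 j)) = 0" and j: "j \<in> {..<d}"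
    have "j \<in> h ` T" using j bij_betw_imp_surj_on[OF h] by simp
    then obtain s where s: "s \<in> T" "h s = j" by auto
    have "(\<Sum>i\<in>{..<d}. c i * (q s i - q s0 i)) = (\<Sum>i\<in>{..<d}. if i = j then c i else 0)"
      using s assms(4) by (intro sum.cong) (auto simp: q_def)
    also have "\<dots> = c j" using j by simp
    finally show "c j = 0" using c s(1) by simp
  qed
  moreover have "(\<lambda>p. p s j - p s0 j) \<in> config_polynomials d V" if "s \<in> T" "j \<in> {..<d}" for s j
    using that assms(2,3) by (intro config_polynomials_diff config_polynomials_coordinate) auto
  ultimately have "row_independent T (\<lambda>j s. p s j - p s0 j) {..<d}"
    by (intro generic_row_independent[OF assms(1), where M = "\<lambda>j s p. p s j - p s0 j" and q = q]) simp
  then show ?thesis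
    by (rule row_independent_solve[OF finite_lessThan assms(5)])
qed

text \<open>Fix \<open>d\<close> common vertices, one of them the origin \<open>s0\<close>, and write
  \<open>B s t\<close> for the product of the position of \<open>s\<close> with the velocity of \<open>t\<close>,
  both relative to \<open>s0\<close>. A pair \<open>s, t\<close> keeps its length exactly if
  \<open>B s t + B t s = 0\<close>, given that both keep their distances to \<open>s0\<close>. For
  \<open>a\<close> on one side and \<open>b\<close> on the other, expand the position of \<open>b\<close> in
  the basis given by \<open>a\<close> and the common vertices. The two bodies then agree on the
  common hyperplane, and the only way to differ would be by a skew matrix with a hyperplane in its
  kernel, which is zero.\<close>
lemma rigid_bodies_glue:
  assumes "d > 0" "finite V1" "finite V2" "card (V1 \<inter> V2) \<ge> d" "generic d (V1 \<union> V2) p"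
    and x1: "infinitesimal_motion d p (complete_edges V1) x"
    and x2: "infinitesimal_motion d p (complete_edges V2) x"
  shows "infinitesimal_motion d p (complete_edges (V1 \<union> V2)) x"
proof -
  obtain S where S: "S \<subseteq> V1 \<inter> V2" "card S = d" "finite S"
    using obtain_subset_with_card_n[OF assms(4)] by metis
  then obtain s0 where s0: "s0 \<in> S" using assms(1) by (metis card.empty equals0I less_irrefl)
  define T where "T = S - {s0}"
  have T: "T \<subseteq> V1" "T \<subseteq> V2" "s0 \<notin> T" "finite T" "Suc (card T) = d" "s0 \<in> V1" "s0 \<in> V2"
    using S s0 card_Suc_Diff1[OF S(3) s0] by (auto simp: T_def)
  define P where "P s j = p s j - p s0 j" for s j
  define X where "X s j = x s j - x s0 j" for s j
  define B where "B s t = (\<Sum>j<d. P s j * X t j)" for s t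
  have strain_B: "strain d p x {s, t} = 2 * (B s s - B s t - B t s + B t t)" if "s \<noteq> t" for s t
    unfolding strain_edge[OF that] B_def
    by (simp add: P_def X_def algebra_simps flip: sum.distrib sum_subtractf)
  have B0: "B s0 t = 0" "B t s0 = 0" for t by (simp_all add: B_def P_def X_def)
  have diag: "B s s = 0" if "s \<in> V1 \<or> s \<in> V2" for s
  proof (cases "s = s0")
    case False
    then have "strain d p x {s, s0} = 0"
      using that x1 x2 T(6,7)
      by (auto simp: infinitesimal_motion_def doubleton_mem_complete_edges)
    then show ?thesis using strain_B[OF False] B0 by simp
  qed (simp add: B0)
  have skew: "B s t = - B t s" if "s \<in> V1 \<and> t \<in> V1 \<or> s \<in> V2 \<and> t \<in> V2" for s t
  proof (cases "s = t")
    case True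
    then show ?thesis using diag that by auto
  next
    case False
    then have "strain d p x {s, t} = 0"
      using that x1 x2 by (auto simp: infinitesimal_motion_def doubleton_mem_complete_edges)
    moreover have "B s s = 0" "B t t = 0" using diag that by auto
    ultimately have "- B s t - B t s = 0" using strain_B[OF False] by simp
    then have "B t s = - B s t" by (simp add: diff_eq_eq)
    then show ?thesis by simp
  qed
  have cross: "strain d p x {a, b} = 0" if a: "a \<in> V1 - V2" and b: "b \<in> V2 - V1" for a b
  proof -
    have aT: "a \<notin> T" "a \<noteq> s0" and bT: "b \<notin> T" "b \<noteq> s0" and ab: "a \<noteq> b"
      using a b T by auto
    have card: "card (insert a T) = d" "card (insert b T) = d" using aT bT T by simp_all
    obtain \<alpha> where "\<forall>j\<in>{..<d}. (\<Sum>s\<in>insert a T. (p s j - p s0 j) * \<alpha> s) = P b j"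
      using generic_affine_combination[OF assms(5), of s0 "insert a T" "P b"] card aT T a by auto
    then have \<alpha>: "P b j = (\<Sum>s\<in>insert a T. \<alpha> s * P s j)" if "j < d" for j
      using that by (simp add: P_def mult.commute)
    have "\<alpha> a \<noteq> 0"
    proof
      assume "\<alpha> a = 0"
      let ?c = "\<lambda>s. if s = b then - 1 else \<alpha> s"
      have "(\<Sum>s\<in>insert b T. ?c s * P s j) = 0" if "j < d" for j
      proof -
        have "(\<Sum>s\<in>T. ?c s * P s j) = (\<Sum>s\<in>T. \<alpha> s * P s j)"
          using bT by (intro sum.cong) auto
        then show ?thesis using \<alpha>[OF that] \<open>\<alpha> a = 0\<close> aT bT T(4) by simp
      qed
      moreover have "row_independent {..<d} P (insert b T)"
        using generic_rows_affinely_independent[OF assms(5), of s0 "insert b T"] card bT T b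
        unfolding P_def by auto
      ultimately have "\<forall>s\<in>insert b T. ?c s = 0"
        unfolding row_independent_def by (elim allE[of _ ?c]) auto
      then show False by simp
    qed
    have Bb: "B b t = (\<Sum>s\<in>insert a T. \<alpha> s * B s t)" for t
    proof -
      have "B b t = (\<Sum>j<d. \<Sum>s\<in>insert a T. \<alpha> s * P s j * X t j)"
        unfolding B_def by (intro sum.cong refl) (simp only: lessThan_iff \<alpha> sum_distrib_right)
      also have "\<dots> = (\<Sum>s\<in>insert a T. \<Sum>j<d. \<alpha> s * P s j * X t j)" by (rule sum.swap)
      finally show ?thesis by (simp only: B_def sum_distrib_left mult.assoc)
    qed
    have skewT: "B r s = - B s r" if "r \<in> insert a T" "s \<in> insert a T" for r s
      using that a T(1) by (intro skew) auto
    \<comment> \<open>The defect between the velocity of b and the one that the first body would give to b, paired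
      with the position of t. It vanishes on the common vertices; the coefficient of a is nonzero,
      so it vanishes at a because it vanishes at b.\<close>
    define w where "w t = B t b - (\<Sum>s\<in>insert a T. \<alpha> s * B t s)" for t
    have wT: "w t = 0" if t: "t \<in> T" for t
    proof -
      have "B t b = - (\<Sum>s\<in>insert a T. \<alpha> s * B s t)"
        using skew[of t b] t T b Bb[of t] by auto
      also have "\<dots> = (\<Sum>s\<in>insert a T. \<alpha> s * B t s)"
        unfolding sum_negf[symmetric] using skewT[of t] t
        by (intro sum.cong refl) simp
      finally show ?thesis by (simp add: w_def)
    qed
    have "w b = (\<Sum>s\<in>insert a T. \<alpha> s * w s)"
    proof -
      have "(\<Sum>s\<in>insert a T. \<alpha> s * B b s) =
          (\<Sum>r\<in>insert a T. \<alpha> r * (\<Sum>s\<in>insert a T. \<alpha> s * B r s))"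
        unfolding Bb sum_distrib_left by (subst sum.swap) (simp only: mult.left_commute)
      then show ?thesis
        unfolding w_def Bb[of b] by (simp only: right_diff_distrib sum_subtractf)
    qed
    also have "\<dots> = \<alpha> a * w a" using wT aT(1) T(4) by simp
    finally have wb: "w b = \<alpha> a * w a" .
    have "w b = 0"
    proof -
      define D where "D = (\<Sum>s\<in>insert a T. \<Sum>r\<in>insert a T. \<alpha> s * \<alpha> r * B r s)"
      have "D = (\<Sum>r\<in>insert a T. \<Sum>s\<in>insert a T. \<alpha> s * \<alpha> r * B r s)"
        unfolding D_def by (rule sum.swap)
      also have "\<dots> = (\<Sum>r\<in>insert a T. \<Sum>s\<in>insert a T. - (\<alpha> r * \<alpha> s * B s r))"
      proof (intro sum.cong refl)
        fix r s assume "r \<in> insert a T" "s \<in> insert a T"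
        then show "\<alpha> s * \<alpha> r * B r s = - (\<alpha> r * \<alpha> s * B s r)" by (subst skewT) simp_all
      qed
      also have "\<dots> = - D" unfolding D_def sum_negf ..
      finally have "D = 0" by simp
      moreover have "(\<Sum>s\<in>insert a T. \<alpha> s * B b s) = D"
        unfolding D_def Bb sum_distrib_left by (simp only: mult.assoc)
      ultimately show ?thesis using diag b by (simp add: w_def)
    qed
    with wb \<open>\<alpha> a \<noteq> 0\<close> have "w a = 0" by simp
    then have "B a b = (\<Sum>s\<in>insert a T. \<alpha> s * B a s)" by (simp add: w_def)
    also have "\<dots> = (\<Sum>s\<in>insert a T. - (\<alpha> s * B s a))"
    proof (intro sum.cong refl)
      fix s assume "s \<in> insert a T"
      then show "\<alpha> s * B a s = - (\<alpha> s * B s a)" by (subst skewT) simp_all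
    qed
    also have "\<dots> = - B b a" by (simp only: Bb sum_negf)
    finally show ?thesis using strain_B[OF ab] diag a b by auto
  qed
  show ?thesis
    unfolding infinitesimal_motion_def
  proof
    fix e assume "e \<in> complete_edges (V1 \<union> V2)"
    then obtain a b where e: "e = {a, b}" "a \<in> V1 \<union> V2" "b \<in> V1 \<union> V2" "a \<noteq> b"
      by (rule complete_edgesE)
    consider "a \<in> V1" "b \<in> V1" | "a \<in> V2" "b \<in> V2" | "a \<in> V1 - V2" "b \<in> V2 - V1"
      | "b \<in> V1 - V2" "a \<in> V2 - V1"
      using e(2,3) by blast
    then show "strain d p x e = 0"
    proof cases
      case 4
      then show ?thesis using cross[of b a] e(1) by (simp add: insert_commute)
    qed (use cross x1 x2 e in \<open>auto simp: infinitesimal_motion_def doubleton_mem_complete_edges\<close>)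
  qed
qed

section \<open>Two edges common to both graphs\<close>
text \<open>Infinitesimal rigidity is projectively invariant. The map \<open>q\<close> is the perspective
  transformation with centre \<open>p c\<close> that divides by the affine function \<open>lam\<close>. A
  velocity field \<open>z\<close> at the transformed configuration is pulled back to \<open>y\<close>, and
  every strain is multiplied by the values of \<open>lam\<close> at the two endpoints.\<close>
lemma perspective_strain:
  assumes "a \<noteq> b"
    and lam: "\<And>w. lam w = 1 + t * (1 + (\<Sum>i<d. (p w i - p c i) * k i))"
    and "lam a \<noteq> 0" "lam b \<noteq> 0"
    and q: "\<And>i. q a i = p c i + (p a i - p c i) / lam a" "\<And>i. q b i = p c i + (p b i - p c i) / lam b"
    and y: "\<And>w i. y w i = lam w * z w i - t * (\<Sum>j<d. (p w j - p c j) * z w j) * k i"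
  shows "strain d p y {a, b} = lam a * lam b * strain d q z {a, b}"
proof -
  define P where "P w i = p w i - p c i" for w i
  define K where "K w = (\<Sum>i<d. P w i * k i)" for w
  define Z where "Z w w' = (\<Sum>i<d. P w i * z w' i)" for w w'
  have Y: "(\<Sum>i<d. P w i * y w' i) = lam w' * Z w w' - t * Z w' w' * K w" for w w'
  proof -
    have y': "y w' i = lam w' * z w' i - t * Z w' w' * k i" for i
      by (simp add: y P_def Z_def)
    have "(\<Sum>i<d. P w i * y w' i) =
        (\<Sum>i<d. lam w' * (P w i * z w' i) - (t * Z w' w') * (P w i * k i))"
      unfolding y' by (intro sum.cong refl) (simp add: algebra_simps)
    then show ?thesis
      by (simp only: sum_subtractf sum_distrib_left[symmetric] Z_def[symmetric] K_def[symmetric])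
  qed
  have "(\<Sum>i<d. (p a i - p b i) * (y a i - y b i)) = (\<Sum>i<d. (P a i - P b i) * (y a i - y b i))"
    by (simp add: P_def)
  also have "\<dots> = (\<Sum>i<d. P a i * y a i) - (\<Sum>i<d. P a i * y b i) -
      (\<Sum>i<d. P b i * y a i) + (\<Sum>i<d. P b i * y b i)"
    by (simp add: algebra_simps flip: sum.distrib sum_subtractf)
  also have "\<dots> = lam b * Z a a - lam b * Z a b - lam a * Z b a + lam a * Z b b"
    unfolding Y using lam[of a] lam[of b] unfolding P_def[symmetric] K_def[symmetric]
    by (simp add: algebra_simps)
  also have "\<dots> = (\<Sum>i<d. (lam b * P a i - lam a * P b i) * (z a i - z b i))"
    unfolding Z_def
    by (simp add: algebra_simps sum_distrib_left flip: sum.distrib sum_subtractf)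
  also have "\<dots> = (\<Sum>i<d. lam a * lam b * ((q a i - q b i) * (z a i - z b i)))"
  proof (intro sum.cong refl)
    fix i
    have "lam b * P a i - lam a * P b i = lam a * lam b * (q a i - q b i)"
      unfolding q P_def using assms(3,4) by (simp add: field_simps)
    then show "(lam b * P a i - lam a * P b i) * (z a i - z b i) =
        lam a * lam b * ((q a i - q b i) * (z a i - z b i))" by simp
  qed
  finally show ?thesis
    unfolding strain_edge[OF assms(1)] by (simp add: sum_distrib_left mult_ac)
qed

lemma strain_combination:
  "strain d p (\<lambda>w i. \<alpha> * x w i + \<beta> * y w i) e = \<alpha> * strain d p x e + \<beta> * strain d p y e"
  unfolding strain_def by (simp add: sum_distrib_left sum.distrib algebra_simps)

text \<open>If fixing the length of \<open>e\<close> fixes the length of \<open>f\<close>, then the strain of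
  \<open>f\<close> is a fixed multiple of the strain of \<open>e\<close> on all motions of \<open>H\<close>:
  combine two motions so that \<open>e\<close> is not strained.\<close>
lemma linked_edges_proportional:
  assumes "\<And>x. infinitesimal_motion d p H x \<Longrightarrow> strain d p x e = 0 \<Longrightarrow> strain d p x f = 0"
    and "infinitesimal_motion d p H x" "infinitesimal_motion d p H y"
  shows "strain d p x e * strain d p y f = strain d p y e * strain d p x f"
proof -
  let ?z = "\<lambda>w i. strain d p x e * y w i + (- strain d p y e) * x w i"
  have "infinitesimal_motion d p H ?z"
    using assms(2,3) unfolding infinitesimal_motion_def by (simp only: strain_combination) simp
  moreover have "strain d p ?z e = 0" by (simp only: strain_combination) simp
  ultimately have "strain d p ?z f = 0" by (rule assms(1))
  then show ?thesis by (simp only: strain_combination) simp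
qed

lemma strain_cong:
  assumes "e \<in> complete_edges V" "\<And>w. w \<in> V \<Longrightarrow> p w = q w"
  shows "strain d p x e = strain d q x e"
  using assms(1)
proof (rule complete_edgesE)
  fix a b assume "e = {a, b}" "a \<in> V" "b \<in> V" "a \<noteq> b"
  then show ?thesis using assms(2) by (simp add: strain_edge)
qed

text \<open>In each of the two graphs the ratio of the strains of \<open>f\<close> and \<open>e\<close> is the same
  for all motions. A motion of the union that strains \<open>f\<close> forces the two ratios to be
  equal. The ratio in the first graph can be altered without moving a common vertex: at most
  \<open>d + 1\<close> generic points are affinely independent, so some affine function takes the value 1
  at an endpoint \<open>c\<close> of \<open>e\<close> outside \<open>f\<close> and 0 at all other common
  vertices, and the perspective transformation built from it fixes all common vertices and
  multiplies the strain of \<open>e\<close> by \<open>1 + t\<close>, but not that of \<open>f\<close>. Apply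
  it to the first graph only. For small \<open>t\<close> an edge \<open>f\<close> that is independent of the
  union at \<open>p\<close> is still independent of it at the new configuration, while the two ratios now
  differ, which is a contradiction.\<close>
lemma linked_pair_determined_by_two_sides:
  assumes fin: "finite V1" "finite V2" and card: "card (V1 \<inter> V2) \<le> d + 1"
    and gen: "generic d (V1 \<union> V2) p"
    and H: "H1 \<subseteq> complete_edges V1" "H2 \<subseteq> complete_edges V2"
    and ef: "e \<in> complete_edges (V1 \<inter> V2)" "f \<in> complete_edges (V1 \<inter> V2)" "e \<noteq> f"
    and link1: "\<And>x. infinitesimal_motion d p H1 x \<Longrightarrow> strain d p x e = 0 \<Longrightarrow> strain d p x f = 0"
    and link2: "\<And>x. infinitesimal_motion d p H2 x \<Longrightarrow> strain d p x e = 0 \<Longrightarrow> strain d p x f = 0"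
    and x: "infinitesimal_motion d p (H1 \<union> H2) x"
  shows "strain d p x f = 0"
proof (rule ccontr)
  assume xf: "strain d p x f \<noteq> 0"
  let ?V = "V1 \<union> V2"
  let ?H = "H1 \<union> H2"
  have finV: "finite ?V" using fin by simp
  have HV: "?H \<subseteq> complete_edges ?V"
    using H complete_edges_mono[of V1 ?V] complete_edges_mono[of V2 ?V] by blast
  have fV: "f \<in> complete_edges ?V"
    using ef(2) complete_edges_mono[of "V1 \<inter> V2" ?V] by blast
  have fH: "f \<notin> ?H" using x xf by (auto simp: infinitesimal_motion_def)
  obtain B where B: "B \<subseteq> ?H" "rows_independent d ?V p B"
    and Bmax: "\<And>h. h \<in> ?H - B \<Longrightarrow> \<not> rows_independent d ?V p (insert h B)"
    using exists_maximal_independent_rows[OF finite_edge_set[OF finV HV], where d = d and V = ?V and p = p]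
    by metis
  have fB: "f \<notin> B" "insert f B \<subseteq> complete_edges ?V" using fH fV B(1) HV by auto
  have indep: "rows_independent d ?V p (insert f B)"
    using motion_preserves_dependent_edge[OF finV fB(2,1) B(2)]
      infinitesimal_motion_mono[OF x B(1)] xf by blast

  obtain c c' where e: "e = {c, c'}" "c \<in> V1 \<inter> V2" "c' \<in> V1 \<inter> V2" "c \<noteq> c'" and cf: "c \<notin> f"
  proof -
    obtain a b where ab: "e = {a, b}" "a \<in> V1 \<inter> V2" "b \<in> V1 \<inter> V2" "a \<noteq> b"
      using ef(1) by (rule complete_edgesE)
    obtain r s where rs: "f = {r, s}" using ef(2) by (rule complete_edgesE)
    have "a \<notin> f \<or> b \<notin> f" using ab(1,4) rs ef(3) by auto
    then show thesis
    proof
      assume "a \<notin> f" then show thesis using ab by (intro that[of a b])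
    next
      assume "b \<notin> f" then show thesis using ab by (intro that[of b a]) auto
    qed
  qed
  obtain r s where f: "f = {r, s}" "r \<in> V1 \<inter> V2" "s \<in> V1 \<inter> V2" "r \<noteq> s"
    using ef(2) by (rule complete_edgesE)

  define T where "T = V1 \<inter> V2 - {c}"
  have T: "finite T" "c \<notin> T" "T \<subseteq> ?V" "card T \<le> d"
    using fin card e(2) by (auto simp: T_def)
  have "row_independent {..<d} (\<lambda>w i. p w i - p c i) T"
    using generic_rows_affinely_independent[OF gen _ T(3,2,1,4)] e(2) by simp
  from row_independent_solve[OF T(1) finite_lessThan this, of "\<lambda>_. - 1"]
  obtain k where k: "\<forall>w\<in>T. (\<Sum>i<d. (p w i - p c i) * k i) = - 1" by (elim exE)
  \<comment> \<open>The affine function is 1 at c and 0 at the other common vertices.\<close>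
  define lam where "lam t w = 1 + t * (1 + (\<Sum>i<d. (p w i - p c i) * k i))" for t w
  have lam_T: "lam t w = 1" if "w \<in> T" for t w using k that by (simp add: lam_def)
  have lam_c: "lam t c = 1 + t" for t by (simp add: lam_def)
  define q where "q t w i = (if w \<in> V1 then p c i + (p w i - p c i) / lam t w else p w i)" for t w i
  have q0: "q 0 = p" by (intro ext) (simp add: q_def lam_def)
  have q1: "q t w i = p c i + (p w i - p c i) / lam t w" if "w \<in> V1" for t w i
    using that by (simp add: q_def)
  have q2: "q t w = p w" if "w \<in> V2" for t w
  proof
    fix i show "q t w i = p w i"
    proof (cases "w \<in> V1 \<and> w \<noteq> c")
      case True
      then show ?thesis using q1 lam_T[of w t] that by (simp add: T_def)
    next
      case False
      then show ?thesis by (auto simp: q_def)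
    qed
  qed
  have cont: "isCont (\<lambda>t. q t w i) 0" for w i
    unfolding q_def lam_def by (cases "w \<in> V1") (auto intro!: continuous_intros)
  have "\<forall>\<^sub>F t in at 0. rows_independent d ?V (q t) (insert f B)"
    using cont finV fB(2) by (intro continuous_rows_independent) (simp_all add: q0 indep)
  moreover have "\<forall>\<^sub>F t in at 0. \<forall>w\<in>V1. lam t w \<noteq> 0"
  proof (intro eventually_ball_finite ballI fin(1))
    fix w
    have "isCont (\<lambda>t. lam t w) 0" unfolding lam_def by (intro continuous_intros)
    then show "\<forall>\<^sub>F t in at 0. lam t w \<noteq> 0"
      using tendsto_imp_eventually_ne[of "\<lambda>t. lam t w" "lam 0 w" "at 0" 0]
      by (simp add: isCont_def lam_def)
  qed
  moreover have "\<forall>\<^sub>F t in at (0::complex). t \<noteq> 0" by (simp add: eventually_at_filter)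
  ultimately have "\<forall>\<^sub>F t in at 0. rows_independent d ?V (q t) (insert f B) \<and>
      (\<forall>w\<in>V1. lam t w \<noteq> 0) \<and> t \<noteq> 0"
    by eventually_elim blast
  from eventually_happens'[OF at_neq_bot this]
  obtain t where t: "rows_independent d ?V (q t) (insert f B)" "\<forall>w\<in>V1. lam t w \<noteq> 0" "t \<noteq> 0"
    by blast

  obtain z where zB: "infinitesimal_motion d (q t) B z" and zf: "strain d (q t) z f \<noteq> 0"
    using motion_straining_independent_edge[OF finV fB(2,1) t(1)] by metis
  \<comment> \<open>The set B still spans the rows of H1 and H2 at the special configuration, since a larger
    independent set there would be independent at p.\<close>
  have zH: "strain d (q t) z h = 0" if h: "h \<in> ?H" for h
  proof (cases "h \<in> B")
    case True
    then show ?thesis using zB by (simp add: infinitesimal_motion_def)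
  next
    case False
    have sub: "insert h B \<subseteq> complete_edges ?V" using h B(1) HV by auto
    have "\<not> rows_independent d ?V (q t) (insert h B)"
      using Bmax[of h] generic_rows_independent[OF gen finV sub, of "q t"] h False by blast
    moreover have "rows_independent d ?V (q t) B"
      using row_independent_mono[OF finite_edge_set[OF finV fB(2)] _ t(1)[unfolded rows_independent_iff]]
      unfolding rows_independent_iff by blast
    ultimately show ?thesis
      using motion_preserves_dependent_edge[OF finV sub False _ _ zB] by metis
  qed

  have strain2: "strain d (q t) z h = strain d p z h" if "h \<in> complete_edges V2" for h
    using that by (rule strain_cong) (rule q2)
  have zH2: "infinitesimal_motion d p H2 z"
    using zH strain2 H(2) unfolding infinitesimal_motion_def by (metis UnI2 subsetD)

  \<comment> \<open>On the second graph z is a motion at p itself; on the first it is pulled back to p.\<close>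
  define y where "y w i = lam t w * z w i - t * (\<Sum>j<d. (p w j - p c j) * z w j) * k i" for w i
  have strain1: "strain d p y {a, b} = lam t a * lam t b * strain d (q t) z {a, b}"
    if "a \<in> V1" "b \<in> V1" "a \<noteq> b" for a b
    using perspective_strain[OF that(3), where lam = "lam t" and t = t and d = d and p = p and c = c
        and k = k and q = "q t" and y = y and z = z] that t(2) q1
    by (simp add: lam_def y_def)
  have yH1: "infinitesimal_motion d p H1 y"
    unfolding infinitesimal_motion_def
  proof
    fix h assume h: "h \<in> H1"
    then obtain a b where ab: "h = {a, b}" "a \<in> V1" "b \<in> V1" "a \<noteq> b"
      using H(1) by (blast elim: complete_edgesE)
    then show "strain d p y h = 0" using strain1[OF ab(2-4)] zH[of h] h by simp
  qed
  have eV2: "e \<in> complete_edges V2" and fV2: "f \<in> complete_edges V2"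
    using e f by (simp_all add: doubleton_mem_complete_edges)
  have ye: "strain d p y e = (1 + t) * strain d p z e"
    using strain1[of c c'] strain2[OF eV2] e lam_T[of c' t] by (simp add: lam_c T_def)
  have yf: "strain d p y f = strain d p z f"
  proof -
    have "lam t r = 1" "lam t s = 1" using f cf by (auto simp: T_def intro!: lam_T)
    then show ?thesis using strain1[of r s] strain2[OF fV2] f by simp
  qed
  have zf': "strain d p z f \<noteq> 0" using zf strain2[OF fV2] by simp

  have "strain d p x e * strain d p y f = strain d p y e * strain d p x f"
    using linked_edges_proportional[OF link1 infinitesimal_motion_mono[OF x] yH1] by simp
  moreover have "strain d p x e * strain d p z f = strain d p z e * strain d p x f"
    using linked_edges_proportional[OF link2 infinitesimal_motion_mono[OF x] zH2] by simp
  ultimately have "t * (strain d p z e * strain d p x f) = 0"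
    by (simp add: ye yf algebra_simps)
  then have "strain d p z e = 0" using t(3) xf by simp
  then show False using link2[OF zH2] zf' by simp
qed

section \<open>The union without a common edge\<close>
lemma redundantly_d_rigid_motions:
  assumes "finite V" "generic d V p" "E \<subseteq> complete_edges V" "redundantly_d_rigid d V E"
    and "infinitesimal_motion d p (E - {e}) x"
  shows "infinitesimal_motion d p (complete_edges V) x"
proof -
  have "d_rigid d V (E - {e})"
    using assms(4) unfolding redundantly_d_rigid_def by (cases "e \<in> E") auto
  moreover have "E - {e} \<subseteq> complete_edges V" using assms(3) by blast
  ultimately show ?thesis
    using d_rigid_iff_motions[OF assms(1,2)] assms(5) by blast
qed

lemma infinitesimal_motion_insert:
  "infinitesimal_motion d p (insert e F) x \<longleftrightarrow> strain d p x e = 0 \<and> infinitesimal_motion d p F x"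
  by (simp add: infinitesimal_motion_def)

text \<open>If \<open>f\<close> is missing from \<open>E2\<close> or equal to \<open>g\<close>, the second graph
  without \<open>g\<close> is rigid and supplies the edge \<open>g\<close> to the first. If \<open>f\<close> is
  a second common edge, both graphs have lost two edges; redundant rigidity says that in each of
  them fixing \<open>g\<close> fixes \<open>f\<close>, and comparing the two sides gives back \<open>f\<close>.\<close>
lemma motion_of_union_minus_two:
  assumes fin: "finite V1" "finite V2" and card: "card (V1 \<inter> V2) \<le> d + 1"
    and gen: "generic d (V1 \<union> V2) p"
    and E: "E1 \<subseteq> complete_edges V1" "E2 \<subseteq> complete_edges V2"
    and R: "redundantly_d_rigid d V1 E1" "redundantly_d_rigid d V2 E2"
    and g: "g \<in> E1 \<inter> E2" and f: "f \<in> E1"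
    and x: "infinitesimal_motion d p (E1 \<union> E2 - {g} - {f}) x"
  shows "infinitesimal_motion d p (complete_edges V1) x \<and>
    infinitesimal_motion d p (complete_edges V2) x"
proof -
  have gen12: "generic d V1 p" "generic d V2 p" using gen generic_mono by blast+
  note M1 = redundantly_d_rigid_motions[OF fin(1) gen12(1) E(1) R(1)]
  note M2 = redundantly_d_rigid_motions[OF fin(2) gen12(2) E(2) R(2)]
  have M2': "infinitesimal_motion d p (complete_edges V2) x \<Longrightarrow>
      infinitesimal_motion d p (complete_edges V1) x"
  proof -
    assume "infinitesimal_motion d p (complete_edges V2) x"
    then have "strain d p x g = 0" using g E(2) by (auto simp: infinitesimal_motion_def)
    then have "infinitesimal_motion d p (insert g (E1 \<union> E2 - {g} - {f})) x"
      using x unfolding infinitesimal_motion_insert by blast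
    then have "infinitesimal_motion d p (E1 - {f}) x"
      by (rule infinitesimal_motion_mono) blast
    then show ?thesis by (rule M1)
  qed
  show ?thesis
  proof (cases "f \<in> E2 \<and> f \<noteq> g")
    case False
    then have "E2 - {g} \<subseteq> E1 \<union> E2 - {g} - {f}" by blast
    then show ?thesis using M2 M2' infinitesimal_motion_mono[OF x] by blast
  next
    case True
    let ?H1 = "E1 - {g} - {f}" and ?H2 = "E2 - {g} - {f}"
    have "complete_edges V1 \<inter> complete_edges V2 \<subseteq> complete_edges (V1 \<inter> V2)"
      by (auto elim!: complete_edgesE simp: doubleton_mem_complete_edges doubleton_eq_iff)
    then have gf: "g \<in> complete_edges (V1 \<inter> V2)" "f \<in> complete_edges (V1 \<inter> V2)"
      using g f True E by blast+
    have link1: "strain d p y f = 0"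
      if "infinitesimal_motion d p ?H1 y" "strain d p y g = 0" for y
    proof -
      have "infinitesimal_motion d p (insert g ?H1) y"
        using that unfolding infinitesimal_motion_insert by blast
      then have "infinitesimal_motion d p (E1 - {f}) y"
        by (rule infinitesimal_motion_mono) blast
      then show ?thesis using M1 f E(1) by (auto simp: infinitesimal_motion_def)
    qed
    have link2: "strain d p y f = 0"
      if "infinitesimal_motion d p ?H2 y" "strain d p y g = 0" for y
    proof -
      have "infinitesimal_motion d p (insert g ?H2) y"
        using that unfolding infinitesimal_motion_insert by blast
      then have "infinitesimal_motion d p (E2 - {f}) y"
        by (rule infinitesimal_motion_mono) blast
      then show ?thesis using M2 True E(2) by (auto simp: infinitesimal_motion_def)
    qed
    have "strain d p x f = 0"
    proof (rule linked_pair_determined_by_two_sides[OF fin card gen _ _ gf _ link1 link2])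
      show "?H1 \<subseteq> complete_edges V1" "?H2 \<subseteq> complete_edges V2" using E by blast+
      show "g \<noteq> f" using True by blast
      show "infinitesimal_motion d p (?H1 \<union> ?H2) x"
        by (rule infinitesimal_motion_mono[OF x]) blast
    qed
    then have "infinitesimal_motion d p (insert f (E1 \<union> E2 - {g} - {f})) x"
      using x unfolding infinitesimal_motion_insert by blast
    then have "infinitesimal_motion d p (E2 - {g}) x"
      by (rule infinitesimal_motion_mono) blast
    then show ?thesis using M2 M2' by blast
  qed
qed

theorem theorem5p6:
  fixes d :: nat
    and V1 V2 :: "'v set"
    and E1 E2 :: "'v set set"
    and u v :: 'v
  assumes "d > 0"
    and "simple_graph V1 E1"
    and "simple_graph V2 E2"
    and "card (V1 \<inter> V2) \<in> {d, d + 1}"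
    and "redundantly_d_rigid d V1 E1"
    and "redundantly_d_rigid d V2 E2"
    and "{u, v} \<in> E1 \<inter> E2"
  shows "redundantly_d_rigid d (V1 \<union> V2) ((E1 \<union> E2) - {{u, v}})"
proof -
  let ?V = "V1 \<union> V2" and ?E = "E1 \<union> E2" and ?g = "{u, v}"
  have fin: "finite V1" "finite V2" and E: "E1 \<subseteq> complete_edges V1" "E2 \<subseteq> complete_edges V2"
    using assms(2,3) by (simp_all add: simple_graph_def)
  have finV: "finite ?V" using fin by simp
  have EV: "?E \<subseteq> complete_edges ?V"
    using E complete_edges_mono[of V1 ?V] complete_edges_mono[of V2 ?V] by blast
  have card: "card (V1 \<inter> V2) \<ge> d" "card (V1 \<inter> V2) \<le> d + 1" using assms(4) by auto
  obtain p where p: "generic d ?V p" using exists_generic[OF finV] by blast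
  have *: "d_rigid d ?V (?E - {?g} - {f})" if "f \<in> ?E" for f
  proof -
    have "infinitesimal_motion d p (complete_edges V1) x \<and>
        infinitesimal_motion d p (complete_edges V2) x"
      if x: "infinitesimal_motion d p (?E - {?g} - {f}) x" for x
      using \<open>f \<in> ?E\<close>
    proof
      assume f: "f \<in> E1"
      show ?thesis
        by (rule motion_of_union_minus_two[OF fin card(2) p E assms(5,6,7) f x])
    next
      assume f: "f \<in> E2"
      show ?thesis
        using motion_of_union_minus_two[OF fin(2,1) _ _ E(2,1) assms(6,5) _ f, of p ?g x]
          card(2) p assms(7) x by (simp add: Un_commute Int_commute)
    qed
    then have "infinitesimal_motion d p (complete_edges ?V) x"
      if "infinitesimal_motion d p (?E - {?g} - {f}) x" for x
      using rigid_bodies_glue[OF assms(1) fin card(1) p] that by blast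
    moreover have "?E - {?g} - {f} \<subseteq> complete_edges ?V" using EV by blast
    ultimately show ?thesis by (simp only: d_rigid_iff_motions[OF finV p]) blast
  qed
  have "d_rigid d ?V (?E - {?g})"
    using *[of ?g] assms(7) by simp
  then show ?thesis
    unfolding redundantly_d_rigid_def using * by blast
qed

end
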